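(* Let $G$ be a deterministic $d$-regular graph on $n$ vertices, let $\lambda_2$ be the second largest eigenvalue of $\frac1dA_G$ and $\lambda_n$ its smallest eigenvalue, and assume $\lambda_2<1$. Let $\varepsilon\in(0,1/2)$ and $\delta>0$. If $$\frac{d}{\log n}\ \ge\ 4\frac{1+|\lambda_n|}{(1-\lambda_2)^2}(1+\delta)\left[\frac{1}{(1-2\varepsilon)^2}+\frac13\frac{1-\lambda_2}{(1-2\varepsilon)(1+|\lambda_n|)}+\frac13\frac{1-\lambda_2}{1+|\lambda_n|}-1\right],$$ then with probability at least $1-n^{-\delta}$ the semidefinite program $\max\operatorname{Tr}(WX)$ s.t. $X\succeq0$, $X_{ii}=1\ \forall i$, has $gg^T$ as its unique optimal solution, where $g_i=(-1)^{x_i}$. As $\varepsilon\to1/2$ the condition can be written $\frac{d}{\log n}\ge4\frac{1+|\lambda_n|}{(1-\lambda_2)^2}(1+\delta)\left[\frac{1}{(1-2\varepsilon)^2}+o\!\left(\frac{1}{(1-2\varepsilon)^2}\right)\right]$, and if moreover $\lambda_2=o(1)$ and $|\lambda_n|=o(1)$ it reads $\frac{d}{\log n}\ge\frac{4(1+\delta)}{(1-2\varepsilon)^2}+o\!\left(\frac{1}{(1-2\varepsilon)^2}\right)$.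
   Context: Model: $G=(V,E)$, $V=[n]$, with adjacency matrix $A_G$; unknown $x\in\{0,1\}^n$; for each edge $(i,j)$ one observes $Y_{(i,j)}=x_i\oplus x_j\oplus Z_{(i,j)}$ (mod 2) with $Z_{(i,j)}$ i.i.d. Bernoulli$(\varepsilon)$. $W\in\mathbb{R}^{n\times n}$ has $W(i,j)=(-1)^{Y_{(i,j)}}$ if $(i,j)\in E$ and $0$ otherwise. Equivalently $\lambda_2=\frac1d\max_{x\perp\mathbf 1}\frac{x^TA_Gx}{x^Tx}$ and $|\lambda_n|=\frac1d\max_{x\perp\mathbf 1}\left(-\frac{x^TA_Gx}{x^Tx}\right)$. Logarithms are natural. *)

theory Defs
  imports "HOL-Probability.Probability"
begin

text \<open>Vertices are 0,...,n-1. A simple graph is a symmetric irreflexive relation E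
  on {0..<n}. Vectors / matrices are functions nat => real (nat => nat => real)
  of which only the entries with indices < n matter.\<close>

definition simple_graph :: "nat \<Rightarrow> (nat \<Rightarrow> nat \<Rightarrow> bool) \<Rightarrow> bool" where
  "simple_graph n E \<longleftrightarrow> (\<forall>i j. E i j \<longrightarrow> i < n \<and> j < n) \<and>
     (\<forall>i j. E i j \<longrightarrow> E j i) \<and> (\<forall>i. \<not> E i i)"

definition regular :: "nat \<Rightarrow> (nat \<Rightarrow> nat \<Rightarrow> bool) \<Rightarrow> nat \<Rightarrow> bool" where
  "regular n E d \<longleftrightarrow> (\<forall>i<n. card {j. j < n \<and> E i j} = d)"

definition adj :: "(nat \<Rightarrow> nat \<Rightarrow> bool) \<Rightarrow> nat \<Rightarrow> nat \<Rightarrow> real" where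
  "adj E i j = (if E i j then 1 else 0)"

definition quad_form :: "nat \<Rightarrow> (nat \<Rightarrow> nat \<Rightarrow> real) \<Rightarrow> (nat \<Rightarrow> real) \<Rightarrow> real" where
  "quad_form n M x = (\<Sum>i<n. \<Sum>j<n. x i * M i j * x j)"

text \<open>(The max below is attained; Sup is used since the set of quotients is infinite.) Rayleigh quotients x^T A x / x^T x over nonzero x in R^n orthogonal to the all-ones vector.\<close>
definition rayleigh_perp :: "nat \<Rightarrow> (nat \<Rightarrow> nat \<Rightarrow> real) \<Rightarrow> real set" where
  "rayleigh_perp n M = {quad_form n M x / (\<Sum>i<n. (x i)\<^sup>2) | x.
       (\<Sum>i<n. x i) = 0 \<and> (\<exists>i<n. x i \<noteq> 0)}"

definition lambda2 :: "nat \<Rightarrow> (nat \<Rightarrow> nat \<Rightarrow> bool) \<Rightarrow> nat \<Rightarrow> real" where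
  "lambda2 n E d = (1 / real d) * Sup (rayleigh_perp n (adj E))"

definition abs_lambda_n :: "nat \<Rightarrow> (nat \<Rightarrow> nat \<Rightarrow> bool) \<Rightarrow> nat \<Rightarrow> real" where
  "abs_lambda_n n E d = (1 / real d) * Sup (uminus ` rayleigh_perp n (adj E))"

definition edge_set :: "(nat \<Rightarrow> nat \<Rightarrow> bool) \<Rightarrow> (nat \<times> nat) set" where
  "edge_set E = {(i, j). i < j \<and> E i j}"

definition noise_pmf :: "(nat \<Rightarrow> nat \<Rightarrow> bool) \<Rightarrow> real \<Rightarrow> (nat \<times> nat \<Rightarrow> bool) pmf" where
  "noise_pmf E eps = Pi_pmf (edge_set E) False (\<lambda>_. bernoulli_pmf eps)"

text \<open>Observation Y_(i,j) = x_i xor x_j xor Z_(i,j) (bits as bools, True = 1).\<close>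
definition obs :: "(nat \<Rightarrow> bool) \<Rightarrow> (nat \<times> nat \<Rightarrow> bool) \<Rightarrow> nat \<Rightarrow> nat \<Rightarrow> bool" where
  "obs x Z i j = ((x i \<noteq> x j) \<noteq> Z (min i j, max i j))"

definition Wmat :: "(nat \<Rightarrow> nat \<Rightarrow> bool) \<Rightarrow> (nat \<Rightarrow> bool) \<Rightarrow> (nat \<times> nat \<Rightarrow> bool) \<Rightarrow> nat \<Rightarrow> nat \<Rightarrow> real" where
  "Wmat E x Z i j = (if E i j then (if obs x Z i j then -1 else 1) else 0)"

definition psd :: "nat \<Rightarrow> (nat \<Rightarrow> nat \<Rightarrow> real) \<Rightarrow> bool" where
  "psd n X \<longleftrightarrow> (\<forall>i<n. \<forall>j<n. X i j = X j i) \<and> (\<forall>v. quad_form n X v \<ge> 0)"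

definition sdp_feasible :: "nat \<Rightarrow> (nat \<Rightarrow> nat \<Rightarrow> real) \<Rightarrow> bool" where
  "sdp_feasible n X \<longleftrightarrow> psd n X \<and> (\<forall>i<n. X i i = 1)"

definition tr_prod :: "nat \<Rightarrow> (nat \<Rightarrow> nat \<Rightarrow> real) \<Rightarrow> (nat \<Rightarrow> nat \<Rightarrow> real) \<Rightarrow> real" where
  "tr_prod n W X = (\<Sum>i<n. \<Sum>j<n. W i j * X j i)"

definition sdp_unique_opt :: "nat \<Rightarrow> (nat \<Rightarrow> nat \<Rightarrow> real) \<Rightarrow> (nat \<Rightarrow> nat \<Rightarrow> real) \<Rightarrow> bool" where
  "sdp_unique_opt n W X0 \<longleftrightarrow> sdp_feasible n X0 \<and>
     (\<forall>X. sdp_feasible n X \<longrightarrow> tr_prod n W X \<le> tr_prod n W X0) \<and>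
     (\<forall>X. sdp_feasible n X \<and> tr_prod n W X = tr_prod n W X0 \<longrightarrow>
          (\<forall>i<n. \<forall>j<n. X i j = X0 i j))"

end

theory Submission
  imports Defs
begin

text \<open>
  Conjugating by the signs \<open>g\<close> reduces to \<open>x = 0\<close>. Dual certification then asks that
  \<open>L\<^sub>G - 2 L\<^sub>H\<close> be positive definite on the complement of the constants, where \<open>H\<close> is the random
  subgraph of flipped edges. Since \<open>L\<^sub>G \<ge> d (1 - \<lambda>\<^sub>2)\<close> there, it suffices that the largest eigenvalue
  of \<open>L\<^sub>H - \<epsilon> L\<^sub>G = \<Sum>\<^sub>e (Z\<^sub>e - \<epsilon>) p\<^sub>e p\<^sub>e\<^sup>\<top>\<close>, with \<open>p\<^sub>e = e\<^sub>i - e\<^sub>j\<close>, stays below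
  \<open>(1 - 2\<epsilon>) d (1 - \<lambda>\<^sub>2) / 2\<close>.

  The matrix Bernstein bound for this sum is obtained without Lieb's theorem. For
  \<open>m(\<theta>) = E tr exp (\<theta> \<Sum>\<^sub>e (Z\<^sub>e - \<epsilon>) p\<^sub>e p\<^sub>e\<^sup>\<top>)\<close>, conditioning on all edges but \<open>e\<close> expresses \<open>m'\<close>
  through the two values of \<open>p\<^sub>e \<bullet> exp(\<dots>) p\<^sub>e\<close> at \<open>Z\<^sub>e = 0, 1\<close>. Adding the rank-one matrix \<open>u u\<^sup>\<top>\<close> to a
  symmetric \<open>K\<close> increases \<open>u \<bullet> e\<^sup>K u\<close> by at most the factor \<open>exp (u \<bullet> u)\<close>, the commuting
  case being extremal. Together with \<open>\<Sum>\<^sub>e p\<^sub>e p\<^sub>e\<^sup>\<top> = L\<^sub>G \<le> d (1 + |\<lambda>\<^sub>n|)\<close> this yields a differential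
  inequality for \<open>m\<close> whose solution is a power of the scalar Bernoulli moment generating function,
  and the scalar Bernstein estimate finishes the proof.
\<close>

section \<open>Positive semidefinite matrices\<close>

definition dot :: "nat \<Rightarrow> (nat \<Rightarrow> real) \<Rightarrow> (nat \<Rightarrow> real) \<Rightarrow> real" where
  "dot n u v = (\<Sum>i<n. u i * v i)"

definition unit_vec :: "nat \<Rightarrow> nat \<Rightarrow> real" where
  "unit_vec i = (\<lambda>j. of_bool (j = i))"

definition mat_vec :: "nat \<Rightarrow> (nat \<Rightarrow> nat \<Rightarrow> real) \<Rightarrow> (nat \<Rightarrow> real) \<Rightarrow> nat \<Rightarrow> real" where
  "mat_vec n K v = (\<lambda>i. \<Sum>j<n. K i j * v j)"

definition sym_mat :: "nat \<Rightarrow> (nat \<Rightarrow> nat \<Rightarrow> real) \<Rightarrow> bool" where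
  "sym_mat n K \<longleftrightarrow> (\<forall>i<n. \<forall>j<n. K i j = K j i)"

definition rank_one_sum ::
  "'e set \<Rightarrow> ('e \<Rightarrow> real) \<Rightarrow> ('e \<Rightarrow> nat \<Rightarrow> real) \<Rightarrow> nat \<Rightarrow> nat \<Rightarrow> real" where
  "rank_one_sum S c p = (\<lambda>i j. \<Sum>e\<in>S. c e * p e i * p e j)"

lemma dot_commute: "dot n u v = dot n v u"
  by (simp add: dot_def mult.commute)

lemma dot_self_nonneg: "0 \<le> dot n u u"
  by (simp add: dot_def sum_nonneg)

lemma dot_self_pos_iff: "0 < dot n u u \<longleftrightarrow> (\<exists>i<n. u i \<noteq> 0)"
proof
  assume "0 < dot n u u"
  then show "\<exists>i<n. u i \<noteq> 0" by (rule contrapos_pp) (simp add: dot_def)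
next
  assume "\<exists>i<n. u i \<noteq> 0"
  then obtain i where "i < n" "u i \<noteq> 0" by blast
  then show "0 < dot n u u"
    unfolding dot_def by (intro sum_pos2[of _ i]) (auto simp: zero_less_mult_iff linorder_neq_iff)
qed

lemma dot_add_right: "dot n u (\<lambda>i. f i + h i) = dot n u f + dot n u h"
  by (simp add: dot_def sum.distrib distrib_left)

lemma dot_scale_right: "dot n u (\<lambda>i. c * f i) = c * dot n u f"
  by (simp add: dot_def sum_distrib_left mult_ac)

lemma dot_sum_right: "dot n u (\<lambda>i. \<Sum>l\<in>I. f l i) = (\<Sum>l\<in>I. dot n u (f l))"
  unfolding dot_def sum_distrib_left by (rule sum.swap)

lemma dot_cong_right: "(\<And>i. i < n \<Longrightarrow> f i = h i) \<Longrightarrow> dot n u f = dot n u h"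
  by (simp add: dot_def)

lemma dot_unit_right: "i < n \<Longrightarrow> dot n u (unit_vec i) = u i"
  by (simp add: dot_def unit_vec_def)

lemma sum_dot_unit: "(\<Sum>i<n. dot n u (unit_vec i) * dot n v (unit_vec i)) = dot n u v"
  unfolding dot_def[of n u v] by (intro sum.cong) (auto simp: dot_unit_right)

lemma dot_Cauchy_Schwarz: "(dot n u v)\<^sup>2 \<le> dot n u u * dot n v v"
  using Cauchy_Schwarz_ineq_sum[of u v "{..<n}"] by (simp add: dot_def power2_eq_square)

lemma quad_form_eq_dot: "quad_form n K v = dot n v (mat_vec n K v)"
  by (simp add: quad_form_def dot_def mat_vec_def sum_distrib_left mult.assoc)

lemma sym_mat_if_psd: "psd n K \<Longrightarrow> sym_mat n K"
  by (simp add: psd_def sym_mat_def)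

lemma psd_iff: "psd n K \<longleftrightarrow> sym_mat n K \<and> (\<forall>v. 0 \<le> quad_form n K v)"
  by (simp add: psd_def sym_mat_def)

lemma dot_mat_vec_commute:
  assumes "sym_mat n K"
  shows "dot n u (mat_vec n K v) = dot n (mat_vec n K u) v"
proof -
  have "dot n u (mat_vec n K v) = (\<Sum>i<n. \<Sum>j<n. u i * (K i j * v j))"
    by (simp add: dot_def mat_vec_def sum_distrib_left)
  also have "\<dots> = (\<Sum>j<n. \<Sum>i<n. u i * (K i j * v j))"
    by (rule sum.swap)
  also have "\<dots> = (\<Sum>j<n. \<Sum>i<n. K j i * u i * v j)"
    using assms by (intro sum.cong refl) (simp add: sym_mat_def)
  also have "\<dots> = dot n (mat_vec n K u) v"
    by (simp add: dot_def mat_vec_def sum_distrib_right)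
  finally show ?thesis .
qed

lemma dot_mat_vec_pow_commute:
  assumes "sym_mat n K"
  shows "dot n u ((mat_vec n K ^^ k) v) = dot n ((mat_vec n K ^^ k) u) v"
proof (induction k arbitrary: u v)
  case (Suc k)
  have "dot n u ((mat_vec n K ^^ Suc k) v) = dot n (mat_vec n K u) ((mat_vec n K ^^ k) v)"
    by (simp add: dot_mat_vec_commute[OF assms])
  also have "\<dots> = dot n ((mat_vec n K ^^ k) (mat_vec n K u)) v" by (rule Suc)
  finally show ?case by (simp add: funpow_swap1)
qed simp

lemma dot_mat_vec_pow_Suc_Suc:
  assumes "sym_mat n K"
  shows "dot n u ((mat_vec n K ^^ Suc (Suc k)) v)
    = dot n (mat_vec n K u) ((mat_vec n K ^^ k) (mat_vec n K v))"
proof -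
  have "(mat_vec n K ^^ Suc (Suc k)) v = mat_vec n K ((mat_vec n K ^^ k) (mat_vec n K v))"
    by (simp add: funpow_swap1)
  then show ?thesis
    by (simp only: dot_mat_vec_commute[OF assms])
qed

lemma mat_vec_unit: "j < n \<Longrightarrow> mat_vec n K (unit_vec j) i = K i j"
  by (simp add: mat_vec_def unit_vec_def)

lemma dot_unit_mat_vec_unit: "i < n \<Longrightarrow> j < n \<Longrightarrow> dot n (unit_vec i) (mat_vec n K (unit_vec j)) = K i j"
  by (subst dot_commute) (simp add: dot_unit_right mat_vec_unit)

lemma sym_mat_rank_one_sum: "sym_mat n (rank_one_sum S c p)"
  by (simp add: sym_mat_def rank_one_sum_def mult_ac)

lemma dot_mat_vec_rank_one_sum:
  "dot n u (mat_vec n (rank_one_sum S c p) v) = (\<Sum>e\<in>S. c e * dot n (p e) u * dot n (p e) v)"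
proof -
  have "mat_vec n (rank_one_sum S c p) v = (\<lambda>i. \<Sum>e\<in>S. c e * dot n (p e) v * p e i)"
  proof
    fix i
    have "mat_vec n (rank_one_sum S c p) v i = (\<Sum>j<n. \<Sum>e\<in>S. c e * p e i * p e j * v j)"
      by (simp add: mat_vec_def rank_one_sum_def sum_distrib_right)
    also have "\<dots> = (\<Sum>e\<in>S. \<Sum>j<n. c e * p e i * p e j * v j)"
      by (rule sum.swap)
    finally show "mat_vec n (rank_one_sum S c p) v i = (\<Sum>e\<in>S. c e * dot n (p e) v * p e i)"
      by (simp add: dot_def sum_distrib_left sum_distrib_right mult_ac)
  qed
  then show ?thesis
    by (simp add: dot_sum_right dot_scale_right) (simp add: dot_commute mult_ac)
qed

lemma quad_form_rank_one_sum: "quad_form n (rank_one_sum S c p) v = (\<Sum>e\<in>S. c e * (dot n (p e) v)\<^sup>2)"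
  by (simp add: quad_form_eq_dot dot_mat_vec_rank_one_sum power2_eq_square mult.assoc)

lemma dot_mat_vec_cong:
  assumes "\<And>i j. i < n \<Longrightarrow> j < n \<Longrightarrow> K i j = K' i j"
  shows "dot n u (mat_vec n K v) = dot n u (mat_vec n K' v)"
  using assms by (intro dot_cong_right) (simp add: mat_vec_def)

lemma quad_form_add_scaled:
  assumes "sym_mat n K"
  shows "quad_form n K (\<lambda>i. u i + s * v i)
    = quad_form n K u + 2 * s * dot n u (mat_vec n K v) + s\<^sup>2 * quad_form n K v"
proof -
  have linear: "mat_vec n K (\<lambda>i. u i + s * v i) = (\<lambda>i. mat_vec n K u i + s * mat_vec n K v i)"
    by (simp add: mat_vec_def fun_eq_iff sum.distrib sum_distrib_left algebra_simps)
  have "dot n v (mat_vec n K u) = dot n u (mat_vec n K v)"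
    by (subst dot_commute) (simp add: dot_mat_vec_commute[OF assms])
  then show ?thesis
    unfolding quad_form_eq_dot linear
    by (subst dot_commute)
       (simp add: dot_add_right dot_scale_right dot_commute[of n "\<lambda>i. _ i + _ i"]
          dot_commute[of n "mat_vec n K _"] algebra_simps power2_eq_square)
qed

lemma psd_Cauchy_Schwarz:
  assumes psd: "psd n K"
  shows "(dot n u (mat_vec n K v))\<^sup>2 \<le> quad_form n K u * quad_form n K v"
proof -
  define b where "b = dot n u (mat_vec n K v)"
  have nonneg: "0 \<le> quad_form n K u + 2 * s * b + s\<^sup>2 * quad_form n K v" for s
    using psd unfolding b_def by (simp add: psd_iff flip: quad_form_add_scaled)
  have quad_nonneg: "0 \<le> quad_form n K v" using psd by (simp add: psd_iff)
  show ?thesis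
  proof (cases "quad_form n K v = 0")
    case True
    have "b = 0"
    proof (rule ccontr)
      assume "b \<noteq> 0"
      then show False
        using nonneg[of "- (quad_form n K u + 1) / (2 * b)"] True by (simp add: field_simps)
    qed
    then show ?thesis using True by (simp add: b_def)
  next
    case False
    with quad_nonneg have "0 < quad_form n K v" by simp
    then show ?thesis
      using nonneg[of "- b / quad_form n K v"]
      by (simp add: b_def[symmetric] power2_eq_square field_simps)
  qed
qed

text \<open>If \<open>X n n = 0\<close>, then row \<open>n\<close> vanishes and the convention \<open>x / 0 = 0\<close> gives the right matrix.\<close>

lemma psd_Schur_complement:
  assumes psd: "psd (Suc n) X"
  shows "psd n (\<lambda>i j. X i j - X n i * X n j / X n n)"
  unfolding psd_def
proof (intro conjI allI impI)
  fix v :: "nat \<Rightarrow> real"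
  define v' where "v' = v(n := 0)"
  define c where "c = (\<Sum>i<n. X n i * v i)"
  have cross: "dot (Suc n) (unit_vec n) (mat_vec (Suc n) X v') = c"
    by (subst dot_commute) (simp add: dot_unit_right mat_vec_def c_def v'_def)
  have corner: "quad_form (Suc n) X (unit_vec n) = X n n"
    by (simp add: quad_form_eq_dot dot_unit_mat_vec_unit)
  have quad: "quad_form (Suc n) X v' = quad_form n X v"
    by (simp add: quad_form_def v'_def)
  have "c\<^sup>2 \<le> X n n * quad_form n X v"
    using psd_Cauchy_Schwarz[OF psd, of "unit_vec n" v'] by (simp only: cross corner quad)
  moreover have "0 \<le> X n n" "0 \<le> quad_form n X v"
    using psd by (simp_all add: psd_iff flip: corner quad)
  ultimately have "c\<^sup>2 / X n n \<le> quad_form n X v"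
    by (cases "X n n = 0") (simp_all add: divide_le_eq mult.commute)
  moreover have "c\<^sup>2 / X n n = (\<Sum>i<n. \<Sum>j<n. v i * (X n i * X n j / X n n) * v j)"
    by (simp add: c_def power2_eq_square sum_product sum_divide_distrib mult_ac)
  ultimately show "0 \<le> quad_form n (\<lambda>i j. X i j - X n i * X n j / X n n) v"
    by (simp add: quad_form_def algebra_simps sum_subtractf)
qed (use psd in \<open>simp add: psd_def mult.commute\<close>)

lemma psd_diag_0_imp_row_0:
  assumes psd: "psd n X" and "i < n" "j < n" "X i i = 0"
  shows "X i j = 0"
  using psd_Cauchy_Schwarz[OF psd, of "unit_vec i" "unit_vec j"] assms
  by (simp add: quad_form_eq_dot dot_unit_mat_vec_unit)

lemma gram_decomposition_Suc:
  fixes w :: "nat \<Rightarrow> nat \<Rightarrow> real"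
  assumes psd: "psd (Suc n) X"
    and gram: "\<And>i j. i < n \<Longrightarrow> j < n \<Longrightarrow> X i j - X n i * X n j / X n n = (\<Sum>l<n. w l i * w l j)"
  shows "\<exists>w'. \<forall>i<Suc n. \<forall>j<Suc n. X i j = (\<Sum>l<Suc n. w' l i * w' l j)"
proof (intro exI allI impI)
  define w' where "w' l i = (if l = n then X n i / sqrt (X n n) else if i = n then 0 else w l i)"
    for l i
  fix i j assume ij: "i < Suc n" "j < Suc n"
  have corner: "0 \<le> X n n"
    using psd by (simp add: psd_iff quad_form_eq_dot flip: dot_unit_mat_vec_unit[of n "Suc n"])
  have last_row: "w' n n * w' n k = X n k" if "k \<le> n" for k
    using psd_diag_0_imp_row_0[OF psd, of n k] that corner
    by (cases "X n n = 0") (simp_all add: w'_def)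
  consider (block) "i < n" "j < n" | (row) "i = n" | (column) "j = n"
    using ij by linarith
  then show "X i j = (\<Sum>l<Suc n. w' l i * w' l j)"
  proof cases
    case block
    then have "(\<Sum>l<n. w' l i * w' l j) = X i j - X n i * X n j / X n n"
      by (simp add: gram w'_def)
    then show ?thesis
      using corner by (simp add: w'_def)
  next
    case row
    then have "(\<Sum>l<n. w' l i * w' l j) = 0" by (simp add: w'_def)
    then show ?thesis using row last_row ij by simp
  next
    case column
    then have "(\<Sum>l<n. w' l i * w' l j) = 0" by (simp add: w'_def)
    moreover have "X i n = X n i"
      using psd ij by (simp add: psd_def)
    ultimately show ?thesis using column last_row[of i] ij by (simp add: mult.commute)
  qed
qed

lemma psd_gram_decomposition:
  assumes "psd n X"
  obtains w :: "nat \<Rightarrow> nat \<Rightarrow> real" where "\<And>i j. i < n \<Longrightarrow> j < n \<Longrightarrow> X i j = (\<Sum>l<n. w l i * w l j)"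
proof -
  have "\<exists>w :: nat \<Rightarrow> nat \<Rightarrow> real. \<forall>i<n. \<forall>j<n. X i j = (\<Sum>l<n. w l i * w l j)"
    using assms
  proof (induction n arbitrary: X)
    case 0
    then show ?case by simp
  next
    case (Suc n)
    obtain w where "\<And>i j. i < n \<Longrightarrow> j < n \<Longrightarrow> X i j - X n i * X n j / X n n = (\<Sum>l<n. w l i * w l j)"
      using Suc.IH[OF psd_Schur_complement[OF Suc.prems]] by blast
    from gram_decomposition_Suc[OF Suc.prems this] show ?case .
  qed
  then show thesis using that by blast
qed

lemma psd_pow_gram_decomposition:
  assumes psd: "psd n K"
  obtains w :: "nat \<Rightarrow> nat \<Rightarrow> real"
  where "\<And>u v. dot n u ((mat_vec n K ^^ k) v) = (\<Sum>l<n. dot n (w l) u * dot n (w l) v)"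
proof -
  have "\<exists>w :: nat \<Rightarrow> nat \<Rightarrow> real.
    \<forall>u v. dot n u ((mat_vec n K ^^ k) v) = (\<Sum>l<n. dot n (w l) u * dot n (w l) v)"
  proof (induction k rule: induct_nat_012)
    case 0
    show ?case
      by (intro exI[of _ unit_vec]) (simp add: dot_commute[of n "unit_vec _"] sum_dot_unit)
  next
    case 1
    obtain w where "\<And>i j. i < n \<Longrightarrow> j < n \<Longrightarrow> K i j = (\<Sum>l<n. w l i * w l j)"
      using psd_gram_decomposition[OF psd] by blast
    then have "dot n u (mat_vec n K v) = dot n u (mat_vec n (rank_one_sum {..<n} (\<lambda>_. 1) w) v)"
      for u v
      by (intro dot_mat_vec_cong) (simp add: rank_one_sum_def)
    then show ?case
      by (intro exI[of _ w]) (simp add: dot_mat_vec_rank_one_sum)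
  next
    case (ge2 k)
    then obtain w where gram:
      "\<And>u v. dot n u ((mat_vec n K ^^ k) v) = (\<Sum>l<n. dot n (w l) u * dot n (w l) v)"
      by blast
    have "dot n u ((mat_vec n K ^^ Suc (Suc k)) v)
        = (\<Sum>l<n. dot n (mat_vec n K (w l)) u * dot n (mat_vec n K (w l)) v)" for u v
      unfolding dot_mat_vec_pow_Suc_Suc[OF sym_mat_if_psd[OF psd]] gram
      by (simp only: dot_mat_vec_commute[OF sym_mat_if_psd[OF psd]])
    then show ?case
      by (intro exI[of _ "\<lambda>l. mat_vec n K (w l)"]) blast
  qed
  then show thesis using that by blast
qed

section \<open>Quadratic forms of matrix powers and exponentials\<close>

definition moment :: "nat \<Rightarrow> (nat \<Rightarrow> nat \<Rightarrow> real) \<Rightarrow> (nat \<Rightarrow> real) \<Rightarrow> nat \<Rightarrow> real" where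
  "moment n K u k = dot n u ((mat_vec n K ^^ k) u)"

definition trace_pow :: "nat \<Rightarrow> (nat \<Rightarrow> nat \<Rightarrow> real) \<Rightarrow> nat \<Rightarrow> real" where
  "trace_pow n K k = (\<Sum>i<n. moment n K (unit_vec i) k)"

definition exp_form :: "nat \<Rightarrow> (nat \<Rightarrow> nat \<Rightarrow> real) \<Rightarrow> (nat \<Rightarrow> real) \<Rightarrow> real \<Rightarrow> real" where
  "exp_form n K u \<theta> = (\<Sum>k. moment n K u k / fact k * \<theta> ^ k)"

definition trace_exp :: "nat \<Rightarrow> (nat \<Rightarrow> nat \<Rightarrow> real) \<Rightarrow> real \<Rightarrow> real" where
  "trace_exp n K \<theta> = (\<Sum>i<n. exp_form n K (unit_vec i) \<theta>)"

definition shift_mat :: "real \<Rightarrow> (nat \<Rightarrow> nat \<Rightarrow> real) \<Rightarrow> nat \<Rightarrow> nat \<Rightarrow> real" where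
  "shift_mat c K = (\<lambda>i j. K i j + c * of_bool (j = i))"

lemma moment_0: "moment n K u 0 = dot n u u"
  by (simp add: moment_def)

lemma moment_Suc_0: "moment n K u (Suc 0) = quad_form n K u"
  by (simp add: moment_def quad_form_eq_dot)

lemma moment_nonneg:
  assumes "psd n K"
  shows "0 \<le> moment n K u k"
proof -
  obtain w where "\<And>u v. dot n u ((mat_vec n K ^^ k) v) = (\<Sum>l<n. dot n (w l) u * dot n (w l) v)"
    using psd_pow_gram_decomposition[OF assms, of k] by blast
  then show ?thesis
    by (simp add: moment_def sum_nonneg)
qed

lemma moment_log_convex:
  assumes psd: "psd n K"
  shows "(moment n K u (Suc k))\<^sup>2 \<le> moment n K u k * moment n K u (Suc (Suc k))"
proof -
  obtain w where gram:
    "\<And>u v. dot n u ((mat_vec n K ^^ k) v) = (\<Sum>l<n. dot n (w l) u * dot n (w l) v)"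
    using psd_pow_gram_decomposition[OF assms, of k] by blast
  let ?Ku = "mat_vec n K u"
  have "moment n K u (Suc k) = (\<Sum>l<n. dot n (w l) u * dot n (w l) ?Ku)"
    by (simp add: moment_def gram funpow_Suc_right del: funpow.simps)
  moreover have "moment n K u (Suc (Suc k)) = (\<Sum>l<n. (dot n (w l) ?Ku)\<^sup>2)"
    unfolding moment_def dot_mat_vec_pow_Suc_Suc[OF sym_mat_if_psd[OF psd]] gram
    by (simp add: power2_eq_square)
  moreover have "moment n K u k = (\<Sum>l<n. (dot n (w l) u)\<^sup>2)"
    by (simp add: moment_def gram power2_eq_square)
  ultimately show ?thesis
    by (simp add: Cauchy_Schwarz_ineq_sum)
qed

lemma log_convex_seq_exchange:
  fixes k :: "nat \<Rightarrow> real"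
  assumes nonneg: "\<And>a. 0 \<le> k a"
    and log_convex: "\<And>a. (k (Suc a))\<^sup>2 \<le> k a * k (Suc (Suc a))"
    and "a \<le> b"
  shows "k (Suc a) * k b \<le> k a * k (Suc b)"
  using \<open>a \<le> b\<close>
proof (induction b rule: dec_induct)
  case base
  then show ?case by simp
next
  case (step b)
  show ?case
  proof (cases "k b = 0")
    case True
    then have "k (Suc b) = 0"
      using log_convex[of b] by simp
    then show ?thesis using nonneg by simp
  next
    case False
    have "k b * (k (Suc a) * k (Suc b)) \<le> k a * (k (Suc b))\<^sup>2"
      using mult_right_mono[OF step.IH nonneg[of "Suc b"]] by (simp add: power2_eq_square mult_ac)
    also have "\<dots> \<le> k a * (k b * k (Suc (Suc b)))"
      by (intro mult_left_mono log_convex nonneg)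
    finally have "k b * (k (Suc a) * k (Suc b)) \<le> k b * (k a * k (Suc (Suc b)))"
      by (simp add: mult_ac)
    then show ?thesis using False nonneg[of b] by simp
  qed
qed

lemma log_convex_seq_mult_le:
  fixes k :: "nat \<Rightarrow> real"
  assumes nonneg: "\<And>a. 0 \<le> k a"
    and log_convex: "\<And>a. (k (Suc a))\<^sup>2 \<le> k a * k (Suc (Suc a))"
  shows "k a * k b \<le> k 0 * k (a + b)"
proof -
  have ordered: "k a * k b \<le> k 0 * k (a + b)" if "a \<le> b" for a b
    using that
  proof (induction a arbitrary: b)
    case 0
    then show ?case by simp
  next
    case (Suc a)
    have "k (Suc a) * k b \<le> k a * k (Suc b)"
      using Suc.prems by (intro log_convex_seq_exchange[where k = k] nonneg log_convex) simp
    also have "\<dots> \<le> k 0 * k (a + Suc b)"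
      using Suc.prems by (intro Suc.IH) simp
    finally show ?case by simp
  qed
  show ?thesis
    using ordered[of a b] ordered[of b a]
    by (cases "a \<le> b") (simp_all add: mult.commute add.commute)
qed

lemma moment_mult_le: "psd n K \<Longrightarrow> moment n K u a * moment n K u b \<le> dot n u u * moment n K u (a + b)"
  using log_convex_seq_mult_le[of "moment n K u"]
  by (simp add: moment_0 moment_nonneg moment_log_convex)

lemma sum_moment_le_trace_pow:
  assumes psd: "psd n K"
    and frame_bound: "\<And>x. (\<Sum>e\<in>S. (dot n (p e) x)\<^sup>2) \<le> \<kappa> * dot n x x"
  shows "(\<Sum>e\<in>S. moment n K (p e) k) \<le> \<kappa> * trace_pow n K k"
proof -
  obtain w where "\<And>u v. dot n u ((mat_vec n K ^^ k) v) = (\<Sum>l<n. dot n (w l) u * dot n (w l) v)"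
    using psd_pow_gram_decomposition[OF psd, of k] by blast
  then have gram: "moment n K u k = (\<Sum>l<n. (dot n (w l) u)\<^sup>2)" for u
    by (simp add: moment_def power2_eq_square)
  have "(\<Sum>e\<in>S. moment n K (p e) k) = (\<Sum>l<n. \<Sum>e\<in>S. (dot n (p e) (w l))\<^sup>2)"
    unfolding gram by (subst sum.swap) (simp add: dot_commute)
  also have "\<dots> \<le> (\<Sum>l<n. \<kappa> * dot n (w l) (w l))"
    by (intro sum_mono frame_bound)
  also have "\<dots> = (\<Sum>l<n. \<kappa> * (\<Sum>i<n. (dot n (w l) (unit_vec i))\<^sup>2))"
    by (simp add: power2_eq_square sum_dot_unit)
  also have "\<dots> = \<kappa> * trace_pow n K k"
    unfolding trace_pow_def gram sum_distrib_left[symmetric] by (subst sum.swap) simp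
  finally show ?thesis .
qed

definition frobenius :: "nat \<Rightarrow> (nat \<Rightarrow> nat \<Rightarrow> real) \<Rightarrow> real" where
  "frobenius n K = sqrt (\<Sum>i<n. \<Sum>j<n. (K i j)\<^sup>2)"

lemma frobenius_nonneg: "0 \<le> frobenius n K"
  by (simp add: frobenius_def sum_nonneg)

lemma dot_mat_vec_self_le: "dot n (mat_vec n K u) (mat_vec n K u) \<le> (frobenius n K)\<^sup>2 * dot n u u"
proof -
  have "dot n (mat_vec n K u) (mat_vec n K u) = (\<Sum>i<n. (\<Sum>j<n. K i j * u j)\<^sup>2)"
    by (simp add: dot_def mat_vec_def power2_eq_square)
  also have "\<dots> \<le> (\<Sum>i<n. (\<Sum>j<n. (K i j)\<^sup>2) * (\<Sum>j<n. (u j)\<^sup>2))"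
    by (intro sum_mono Cauchy_Schwarz_ineq_sum)
  also have "\<dots> = (frobenius n K)\<^sup>2 * dot n u u"
    by (simp add: frobenius_def dot_def sum_nonneg power2_eq_square sum_distrib_right)
  finally show ?thesis .
qed

lemma abs_moment_le: "\<bar>moment n K u k\<bar> \<le> dot n u u * frobenius n K ^ k"
proof (rule power2_le_imp_le)
  have growth: "dot n ((mat_vec n K ^^ k) u) ((mat_vec n K ^^ k) u)
      \<le> (frobenius n K ^ k)\<^sup>2 * dot n u u"
  proof (induction k)
    case (Suc k)
    have "dot n ((mat_vec n K ^^ Suc k) u) ((mat_vec n K ^^ Suc k) u)
        \<le> (frobenius n K)\<^sup>2 * ((frobenius n K ^ k)\<^sup>2 * dot n u u)"
      using order_trans[OF dot_mat_vec_self_le mult_left_mono[OF Suc]] by simp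
    then show ?case by (simp add: power_mult_distrib mult_ac)
  qed simp
  have "\<bar>moment n K u k\<bar>\<^sup>2 \<le> dot n u u * dot n ((mat_vec n K ^^ k) u) ((mat_vec n K ^^ k) u)"
    by (simp add: moment_def dot_Cauchy_Schwarz)
  also have "\<dots> \<le> dot n u u * ((frobenius n K ^ k)\<^sup>2 * dot n u u)"
    by (intro mult_left_mono growth dot_self_nonneg)
  finally show "\<bar>moment n K u k\<bar>\<^sup>2 \<le> (dot n u u * frobenius n K ^ k)\<^sup>2"
    by (simp add: power2_eq_square mult_ac)
qed (simp add: dot_self_nonneg frobenius_nonneg)

lemma summable_norm_exp_form: "summable (\<lambda>k. norm (moment n K u k / fact k * \<theta> ^ k))"
proof -
  have "summable (\<lambda>k. dot n u u * (inverse (fact k) * (frobenius n K * \<bar>\<theta>\<bar>) ^ k))"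
    by (intro summable_mult summable_exp)
  then show ?thesis
  proof (rule summable_comparison_test[rotated], intro exI allI impI)
    fix k :: nat
    have "norm (moment n K u k / fact k * \<theta> ^ k) = \<bar>moment n K u k\<bar> * (\<bar>\<theta>\<bar> ^ k / fact k)"
      by (simp add: abs_mult power_abs)
    also have "\<dots> \<le> dot n u u * frobenius n K ^ k * (\<bar>\<theta>\<bar> ^ k / fact k)"
      by (intro mult_right_mono abs_moment_le) simp
    also have "\<dots> = dot n u u * (inverse (fact k) * (frobenius n K * \<bar>\<theta>\<bar>) ^ k)"
      by (simp add: power_mult_distrib divide_inverse mult_ac)
    finally show "norm (norm (moment n K u k / fact k * \<theta> ^ k))
        \<le> dot n u u * (inverse (fact k) * (frobenius n K * \<bar>\<theta>\<bar>) ^ k)"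
      by simp
  qed
qed

lemma exp_form_sums: "(\<lambda>k. moment n K u k / fact k * \<theta> ^ k) sums exp_form n K u \<theta>"
  unfolding exp_form_def by (rule summable_sums[OF summable_norm_cancel[OF summable_norm_exp_form]])

lemma dot_mat_vec_shift:
  "dot n u (mat_vec n (shift_mat c K) v) = dot n u (mat_vec n K v) + c * dot n u v"
proof -
  have "dot n u (mat_vec n (shift_mat c K) v) = dot n u (\<lambda>i. mat_vec n K v i + c * v i)"
    by (intro dot_cong_right)
      (simp add: mat_vec_def shift_mat_def distrib_right sum.distrib mult.assoc
        flip: sum_distrib_left)
  then show ?thesis by (simp add: dot_add_right dot_scale_right)
qed

lemma quad_form_shift: "quad_form n (shift_mat c K) u = quad_form n K u + c * dot n u u"
  by (simp add: quad_form_eq_dot dot_mat_vec_shift)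

lemma sym_mat_shift: "sym_mat n K \<Longrightarrow> sym_mat n (shift_mat c K)"
  by (auto simp: sym_mat_def shift_mat_def)

lemma psd_shift_frobenius:
  assumes "sym_mat n K"
  shows "psd n (shift_mat (frobenius n K) K)"
proof -
  have "0 \<le> quad_form n (shift_mat (frobenius n K) K) v" for v
    using abs_moment_le[of n K v "Suc 0"] unfolding moment_Suc_0 quad_form_shift
    by (simp add: mult.commute)
  then show ?thesis
    using sym_mat_shift[OF assms] by (simp add: psd_iff)
qed

lemma binomial_sum_Suc:
  fixes c :: "'a :: comm_ring_1"
  shows "(\<Sum>j\<le>Suc m. of_nat (Suc m choose j) * c ^ (Suc m - j) * f j)
    = (\<Sum>j\<le>m. of_nat (m choose j) * c ^ (m - j) * f (Suc j))
      + c * (\<Sum>j\<le>m. of_nat (m choose j) * c ^ (m - j) * f j)"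
proof -
  have "c * (\<Sum>j\<le>m. of_nat (m choose j) * c ^ (m - j) * f j)
      = (\<Sum>j\<le>Suc m. of_nat (m choose j) * c ^ (Suc m - j) * f j)"
    unfolding sum_distrib_left by (simp add: Suc_diff_le mult_ac binomial_eq_0)
  also have "\<dots> = c ^ Suc m * f 0 + (\<Sum>j\<le>m. of_nat (m choose Suc j) * c ^ (m - j) * f (Suc j))"
    by (subst sum.atMost_Suc_shift) simp
  finally show ?thesis
    by (subst sum.atMost_Suc_shift) (simp add: distrib_right sum.distrib)
qed

lemma dot_mat_vec_pow_shift:
  assumes sym: "sym_mat n K"
  shows "dot n ((mat_vec n K ^^ a) u) ((mat_vec n (shift_mat c K) ^^ m) u)
    = (\<Sum>j\<le>m. real (m choose j) * c ^ (m - j) * moment n K u (a + j))"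
proof (induction m arbitrary: a)
  case 0
  then show ?case by (simp add: moment_def dot_commute)
next
  case (Suc m)
  have "dot n ((mat_vec n K ^^ a) u) ((mat_vec n (shift_mat c K) ^^ Suc m) u)
      = dot n ((mat_vec n K ^^ Suc a) u) ((mat_vec n (shift_mat c K) ^^ m) u)
        + c * dot n ((mat_vec n K ^^ a) u) ((mat_vec n (shift_mat c K) ^^ m) u)"
    by (simp add: dot_mat_vec_shift dot_mat_vec_commute[OF sym])
  then show ?case unfolding Suc.IH binomial_sum_Suc by simp
qed

lemma moment_shift:
  "sym_mat n K \<Longrightarrow> moment n (shift_mat c K) u m
    = (\<Sum>j\<le>m. real (m choose j) * c ^ (m - j) * moment n K u j)"
  using dot_mat_vec_pow_shift[of n K 0 u m c] by (simp add: moment_def)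

lemma exp_form_shift:
  assumes "sym_mat n K"
  shows "exp_form n (shift_mat c K) u \<theta> = exp (c * \<theta>) * exp_form n K u \<theta>"
proof -
  have "(\<lambda>m. \<Sum>j\<le>m. (moment n K u j / fact j * \<theta> ^ j) * ((c * \<theta>) ^ (m - j) /\<^sub>R fact (m - j)))
      sums ((\<Sum>m. moment n K u m / fact m * \<theta> ^ m) * (\<Sum>m. (c * \<theta>) ^ m /\<^sub>R fact m))"
    by (intro Cauchy_product_sums summable_norm_exp_form summable_norm_exp)
  moreover have "(\<Sum>j\<le>m. (moment n K u j / fact j * \<theta> ^ j) * ((c * \<theta>) ^ (m - j) /\<^sub>R fact (m - j)))
      = moment n (shift_mat c K) u m / fact m * \<theta> ^ m" for m
    unfolding moment_shift[OF assms] sum_divide_distrib sum_distrib_right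
  proof (intro sum.cong refl)
    fix j assume "j \<in> {..m}"
    then have "j \<le> m" by simp
    moreover from this have "\<theta> ^ m = \<theta> ^ j * \<theta> ^ (m - j)"
      by (simp flip: power_add)
    ultimately show "(moment n K u j / fact j * \<theta> ^ j) * ((c * \<theta>) ^ (m - j) /\<^sub>R fact (m - j))
        = real (m choose j) * c ^ (m - j) * moment n K u j / fact m * \<theta> ^ m"
      by (simp add: binomial_fact power_mult_distrib divide_inverse mult_ac)
  qed
  ultimately have "(\<lambda>m. moment n (shift_mat c K) u m / fact m * \<theta> ^ m)
      sums (exp (c * \<theta>) * exp_form n K u \<theta>)"
    by (simp add: exp_form_def exp_def mult.commute)
  then show ?thesis
    using exp_form_sums sums_unique2 by blast
qed

lemma trace_exp_shift: "sym_mat n K \<Longrightarrow> trace_exp n (shift_mat c K) \<theta> = exp (c * \<theta>) * trace_exp n K \<theta>"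
  by (simp add: trace_exp_def exp_form_shift sum_distrib_left)

lemma exp_form_nonneg:
  assumes sym: "sym_mat n K" and "0 \<le> \<theta>"
  shows "0 \<le> exp_form n K u \<theta>"
proof -
  let ?L = "shift_mat (frobenius n K) K"
  have "0 \<le> exp_form n ?L u \<theta>"
    using \<open>0 \<le> \<theta>\<close> psd_shift_frobenius[OF sym]
    by (intro sums_le[OF _ sums_zero exp_form_sums]) (simp add: moment_nonneg)
  then show ?thesis by (simp add: exp_form_shift[OF sym] zero_le_mult_iff)
qed

lemma trace_exp_nonneg: "sym_mat n K \<Longrightarrow> 0 \<le> \<theta> \<Longrightarrow> 0 \<le> trace_exp n K \<theta>"
  by (simp add: trace_exp_def sum_nonneg exp_form_nonneg)

lemma trace_exp_0: "trace_exp n K 0 = real n"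
proof -
  have "exp_form n K (unit_vec i) 0 = 1" if "i < n" for i
    using that powser_zero[of "\<lambda>k. moment n K (unit_vec i) k / fact k"]
    by (simp add: exp_form_def moment_0 dot_unit_right) (simp add: unit_vec_def)
  then show ?thesis by (simp add: trace_exp_def)
qed

lemma trace_exp_sums: "(\<lambda>k. trace_pow n K k / fact k * \<theta> ^ k) sums trace_exp n K \<theta>"
  unfolding trace_exp_def trace_pow_def sum_divide_distrib sum_distrib_right
  by (intro sums_sum exp_form_sums)

lemma sum_exp_form_le_trace_exp:
  assumes sym: "sym_mat n K" and "0 \<le> \<theta>"
    and frame_bound: "\<And>x. (\<Sum>e\<in>S. (dot n (p e) x)\<^sup>2) \<le> \<kappa> * dot n x x"
  shows "(\<Sum>e\<in>S. exp_form n K (p e) \<theta>) \<le> \<kappa> * trace_exp n K \<theta>"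
proof -
  define c where "c = frobenius n K"
  let ?L = "shift_mat c K"
  have "(\<Sum>e\<in>S. moment n ?L (p e) k / fact k * \<theta> ^ k)
      \<le> \<kappa> * (trace_pow n ?L k / fact k * \<theta> ^ k)" for k
  proof -
    have "(\<Sum>e\<in>S. moment n ?L (p e) k / fact k * \<theta> ^ k)
        = (\<Sum>e\<in>S. moment n ?L (p e) k) / fact k * \<theta> ^ k"
      by (simp add: sum_divide_distrib sum_distrib_right)
    also have "\<dots> \<le> \<kappa> * trace_pow n ?L k / fact k * \<theta> ^ k"
      using \<open>0 \<le> \<theta>\<close> unfolding c_def
      by (intro mult_right_mono divide_right_mono sum_moment_le_trace_pow
          psd_shift_frobenius sym frame_bound) auto
    finally show ?thesis by simp
  qed
  then have "(\<Sum>e\<in>S. exp_form n ?L (p e) \<theta>) \<le> \<kappa> * trace_exp n ?L \<theta>"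
    by (intro sums_le[OF _ sums_sum[OF exp_form_sums] sums_mult[OF trace_exp_sums]])
  then have "exp (c * \<theta>) * (\<Sum>e\<in>S. exp_form n K (p e) \<theta>) \<le> exp (c * \<theta>) * (\<kappa> * trace_exp n K \<theta>)"
    by (simp add: exp_form_shift trace_exp_shift sym sum_distrib_left mult_ac)
  then show ?thesis by simp
qed

lemma exp_form_le_trace_exp:
  assumes "sym_mat n K" "0 \<le> \<theta>"
  shows "exp_form n K u \<theta> \<le> dot n u u * trace_exp n K \<theta>"
  using sum_exp_form_le_trace_exp[OF assms, where S = "{()}" and p = "\<lambda>_. u" and \<kappa> = "dot n u u"]
  by (simp add: dot_Cauchy_Schwarz)

lemma exp_rayleigh_le_exp_form:
  assumes sym: "sym_mat n K" and u_pos: "0 < dot n u u" and "0 \<le> \<theta>"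
  shows "dot n u u * exp (quad_form n K u / dot n u u * \<theta>) \<le> exp_form n K u \<theta>"
proof -
  define c where "c = frobenius n K"
  let ?L = "shift_mat c K"
  define \<tau> where "\<tau> = quad_form n ?L u / dot n u u"
  have psd_shift: "psd n ?L" unfolding c_def using sym by (rule psd_shift_frobenius)
  have \<tau>: "0 \<le> \<tau>" "moment n ?L u (Suc 0) = dot n u u * \<tau>"
    unfolding \<tau>_def using psd_shift u_pos unfolding moment_Suc_0 by (simp_all add: psd_iff)
  have pow: "dot n u u * \<tau> ^ k \<le> moment n ?L u k" for k
  proof (induction k)
    case 0
    then show ?case by (simp add: moment_0)
  next
    case (Suc k)
    have "dot n u u * (\<tau> * moment n ?L u k) \<le> dot n u u * moment n ?L u (Suc k)"
      using moment_mult_le[OF psd_shift, of u "Suc 0" k] by (simp add: \<tau>(2) mult.assoc)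
    with u_pos have "\<tau> * moment n ?L u k \<le> moment n ?L u (Suc k)" by simp
    with mult_left_mono[OF Suc \<open>0 \<le> \<tau>\<close>] show ?case by (simp add: mult_ac)
  qed
  have "dot n u u * ((\<tau> * \<theta>) ^ k /\<^sub>R fact k) \<le> moment n ?L u k / fact k * \<theta> ^ k" for k
    using mult_right_mono[OF pow[of k], of "\<theta> ^ k / fact k"] \<open>0 \<le> \<theta>\<close>
    by (simp add: power_mult_distrib divide_inverse mult_ac)
  then have "dot n u u * exp (\<tau> * \<theta>) \<le> exp_form n ?L u \<theta>"
    by (intro sums_le[OF _ sums_mult[OF exp_converges] exp_form_sums])
  moreover have "\<tau> = quad_form n K u / dot n u u + c"
    using u_pos by (simp add: \<tau>_def quad_form_shift add_divide_distrib)
  ultimately have "exp (c * \<theta>) * (dot n u u * exp (quad_form n K u / dot n u u * \<theta>))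
      \<le> exp (c * \<theta>) * exp_form n K u \<theta>"
    by (simp only: exp_form_shift[OF sym] ring_distribs exp_add mult_ac)
  then show ?thesis by simp
qed

lemma moment_mult_shift_le:
  assumes psd: "psd n K" and "0 \<le> c"
  shows "moment n K u a * dot n ((mat_vec n K ^^ b) u) ((mat_vec n (shift_mat c K) ^^ m) u)
    \<le> dot n u u * dot n ((mat_vec n K ^^ (a + b)) u) ((mat_vec n (shift_mat c K) ^^ m) u)"
proof -
  have "moment n K u a * (real (m choose j) * c ^ (m - j) * moment n K u (b + j))
      \<le> dot n u u * (real (m choose j) * c ^ (m - j) * moment n K u (a + b + j))" for j
    using mult_left_mono[OF moment_mult_le[OF psd, of u a "b + j"],
        of "real (m choose j) * c ^ (m - j)"] \<open>0 \<le> c\<close>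
    by (simp add: mult_ac add.assoc)
  then show ?thesis
    unfolding dot_mat_vec_pow_shift[OF sym_mat_if_psd[OF psd]] sum_distrib_left by (rule sum_mono)
qed

definition rank_one_update :: "(nat \<Rightarrow> nat \<Rightarrow> real) \<Rightarrow> (nat \<Rightarrow> real) \<Rightarrow> nat \<Rightarrow> nat \<Rightarrow> real" where
  "rank_one_update K u = (\<lambda>i j. K i j + u i * u j)"

lemma sym_mat_rank_one_update: "sym_mat n K \<Longrightarrow> sym_mat n (rank_one_update K u)"
  by (simp add: sym_mat_def rank_one_update_def mult.commute)

lemma rank_one_update_shift: "rank_one_update (shift_mat c K) u = shift_mat c (rank_one_update K u)"
  by (simp add: rank_one_update_def shift_mat_def fun_eq_iff)

lemma dot_mat_vec_rank_one_update:
  "dot n v (mat_vec n (rank_one_update K u) x) = dot n v (mat_vec n K x) + dot n u x * dot n v u"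
proof -
  have "mat_vec n (rank_one_update K u) x = (\<lambda>i. mat_vec n K x i + dot n u x * u i)"
    by (simp add: fun_eq_iff mat_vec_def rank_one_update_def dot_def
        sum.distrib sum_distrib_left algebra_simps)
  then show ?thesis by (simp add: dot_add_right dot_scale_right)
qed

text \<open>Every word in \<open>K\<close> and \<open>u u\<^sup>\<top>\<close> evaluates to a product of moments, which log-convexity
  bounds by a single moment, as if \<open>u\<close> were an eigenvector.\<close>

lemma moment_rank_one_update_le:
  assumes psd: "psd n K"
  shows "moment n (rank_one_update K u) u m \<le> moment n (shift_mat (dot n u u) K) u m"
proof -
  let ?U = "mat_vec n (rank_one_update K u)" and ?L = "mat_vec n (shift_mat (dot n u u) K)"
  have "dot n ((mat_vec n K ^^ a) u) ((?U ^^ m) u) \<le> dot n ((mat_vec n K ^^ a) u) ((?L ^^ m) u)"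
    for a
  proof (induction m arbitrary: a)
    case (Suc m)
    let ?v = "(mat_vec n K ^^ a) u"
    have "dot n ?v ((?U ^^ Suc m) u)
        = dot n ((mat_vec n K ^^ Suc a) u) ((?U ^^ m) u)
          + moment n K u a * dot n ((mat_vec n K ^^ 0) u) ((?U ^^ m) u)"
      by (simp add: dot_mat_vec_rank_one_update dot_mat_vec_commute[OF sym_mat_if_psd[OF psd]]
          moment_def dot_commute[of n ?v u] mult.commute)
    also have "\<dots> \<le> dot n ((mat_vec n K ^^ Suc a) u) ((?L ^^ m) u)
        + moment n K u a * dot n ((mat_vec n K ^^ 0) u) ((?L ^^ m) u)"
      by (intro add_mono mult_left_mono Suc moment_nonneg psd)
    also have "\<dots> \<le> dot n ((mat_vec n K ^^ Suc a) u) ((?L ^^ m) u)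
        + dot n u u * dot n ?v ((?L ^^ m) u)"
      using moment_mult_shift_le[OF psd dot_self_nonneg, of u a 0] by (intro add_left_mono) simp
    also have "\<dots> = dot n ?v ((?L ^^ Suc m) u)"
      by (simp add: dot_mat_vec_shift dot_mat_vec_commute[OF sym_mat_if_psd[OF psd]])
    finally show ?case .
  qed simp
  from this[of 0] show ?thesis by (simp add: moment_def)
qed

lemma exp_form_rank_one_update_le:
  assumes sym: "sym_mat n K" and "0 \<le> \<theta>"
  shows "exp_form n (rank_one_update K u) u \<theta> \<le> exp (dot n u u * \<theta>) * exp_form n K u \<theta>"
proof -
  define c where "c = frobenius n K"
  have "moment n (rank_one_update (shift_mat c K) u) u m / fact m * \<theta> ^ m
      \<le> moment n (shift_mat (dot n u u) (shift_mat c K)) u m / fact m * \<theta> ^ m" for m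
    using \<open>0 \<le> \<theta>\<close> sym unfolding c_def
    by (intro mult_right_mono divide_right_mono moment_rank_one_update_le
        psd_shift_frobenius) simp_all
  then have "exp_form n (rank_one_update (shift_mat c K) u) u \<theta>
      \<le> exp_form n (shift_mat (dot n u u) (shift_mat c K)) u \<theta>"
    by (intro sums_le[OF _ exp_form_sums exp_form_sums])
  then have "exp (c * \<theta>) * exp_form n (rank_one_update K u) u \<theta>
      \<le> exp (c * \<theta>) * (exp (dot n u u * \<theta>) * exp_form n K u \<theta>)"
    by (simp add: rank_one_update_shift exp_form_shift sym
        sym_mat_rank_one_update sym_mat_shift mult_ac)
  then show ?thesis by simp
qed

section \<open>Scalar estimates\<close>

definition bernoulli_cgf :: "real \<Rightarrow> real \<Rightarrow> real" where
  "bernoulli_cgf eps s = ln (1 - eps + eps * exp s) - eps * s"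

definition bernoulli_cgf_deriv :: "real \<Rightarrow> real \<Rightarrow> real" where
  "bernoulli_cgf_deriv eps s = eps * (1 - eps) * (exp s - 1) / (1 - eps + eps * exp s)"

lemma bernoulli_mgf_pos:
  fixes eps :: real
  shows "0 \<le> eps \<Longrightarrow> eps < 1 \<Longrightarrow> 0 < 1 - eps + eps * exp s"
  by (simp add: add_pos_nonneg)

lemma has_real_derivative_bernoulli_cgf:
  assumes "0 \<le> eps" "eps < 1"
  shows "(bernoulli_cgf eps has_real_derivative bernoulli_cgf_deriv eps s) (at s)"
proof -
  have pos: "0 < 1 - eps + eps * exp s" using assms by (rule bernoulli_mgf_pos)
  then have "(bernoulli_cgf eps has_real_derivative
      eps * exp s / (1 - eps + eps * exp s) - eps) (at s)"
    unfolding bernoulli_cgf_def by (auto intro!: derivative_eq_intros)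
  moreover have "eps * exp s / (1 - eps + eps * exp s) - eps = bernoulli_cgf_deriv eps s"
    using pos by (simp add: bernoulli_cgf_deriv_def field_simps)
  ultimately show ?thesis by simp
qed

lemma bernoulli_cgf_deriv_nonneg:
  assumes "0 \<le> eps" "eps < 1" "0 \<le> s"
  shows "0 \<le> bernoulli_cgf_deriv eps s"
  using bernoulli_mgf_pos[of eps s] assms by (simp add: bernoulli_cgf_deriv_def)

text \<open>Here \<open>x\<close> and \<open>y\<close> are the values at \<open>Z = 1\<close> and \<open>Z = 0\<close> of a function of a Bernoulli
  variable \<open>Z\<close>.\<close>

lemma bernoulli_covariance_le:
  fixes x y :: real
  assumes eps: "0 \<le> eps" "eps < 1" and tilt: "x \<le> exp s * y"
  shows "eps * ((1 - eps) * x) + (1 - eps) * (- eps * y)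
    \<le> bernoulli_cgf_deriv eps s * (eps * x + (1 - eps) * y)"
proof -
  have "(x - y) * (1 - eps + eps * exp s) \<le> (exp s - 1) * (eps * x + (1 - eps) * y)"
    using tilt by (simp add: algebra_simps)
  then have "eps * (1 - eps) * ((x - y) * (1 - eps + eps * exp s))
      \<le> eps * (1 - eps) * ((exp s - 1) * (eps * x + (1 - eps) * y))"
    using eps by (intro mult_left_mono) auto
  then have "eps * (1 - eps) * (x - y) \<le> bernoulli_cgf_deriv eps s * (eps * x + (1 - eps) * y)"
    using bernoulli_mgf_pos[OF eps, of s]
    by (simp add: bernoulli_cgf_deriv_def pos_le_divide_eq mult_ac)
  then show ?thesis by (simp add: algebra_simps)
qed

lemma exp_minus_linear_le: "(exp x - 1 - x) * (1 - x / 3) \<le> x\<^sup>2 / 2" for x :: real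
proof -
  define h where "h x = x\<^sup>2 / 2 - (exp x - 1 - x) * (1 - x / 3)" for x :: real
  define h' where "h' x = (2 * x + (x - 2) * (exp x - 1)) / 3" for x :: real
  have "h' 0 * (x - 0) \<le> h x - h 0"
  proof (rule f''_imp_f'[of UNIV])
    fix y :: real
    show "(h has_real_derivative h' y) (at y)"
      unfolding h_def h'_def by (auto intro!: derivative_eq_intros simp: field_simps)
    show "(h' has_real_derivative (1 + (y - 1) * exp y) / 3) (at y)"
      unfolding h'_def by (auto intro!: derivative_eq_intros simp: field_simps)
    have "(1 - y) * exp y \<le> exp (- y) * exp y"
      using exp_ge_add_one_self[of "- y"] by (intro mult_right_mono) auto
    then show "0 \<le> (1 + (y - 1) * exp y) / 3" by (simp add: exp_minus field_simps)
  qed simp_all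
  then show ?thesis by (simp add: h_def h'_def)
qed

lemma exp_minus_linear_le_uniform:
  fixes y z :: real
  assumes "y \<le> z" "z < 3"
  shows "exp y - 1 - y \<le> y\<^sup>2 / 2 / (1 - z / 3)"
proof -
  have "0 \<le> exp y - 1 - y"
    using exp_ge_add_one_self[of y] by linarith
  then have "(exp y - 1 - y) * (1 - z / 3) \<le> (exp y - 1 - y) * (1 - y / 3)"
    using assms by (intro mult_left_mono) auto
  also have "\<dots> \<le> y\<^sup>2 / 2" by (rule exp_minus_linear_le)
  finally show ?thesis
    using assms by (subst pos_le_divide_eq) auto
qed

lemma bernoulli_cgf_le:
  assumes eps: "0 \<le> eps" "eps < 1" and s: "0 \<le> s" "(1 - eps) * s < 3"
  shows "bernoulli_cgf eps s \<le> eps * (1 - eps) * s\<^sup>2 / 2 / (1 - (1 - eps) * s / 3)"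
proof -
  let ?M = "1 - eps + eps * exp s"
  define y1 where "y1 = (1 - eps) * s"
  define y0 where "y0 = - (eps * s)"
  have pos: "0 < ?M" using eps by (rule bernoulli_mgf_pos)
  have "0 \<le> eps * s" "0 \<le> (1 - eps) * s" using eps s by simp_all
  then have "y0 \<le> y1" unfolding y0_def y1_def by linarith
  have "bernoulli_cgf eps s = ln (?M * exp y0)"
    using pos by (simp add: bernoulli_cgf_def ln_mult y0_def)
  also have "\<dots> \<le> ?M * exp y0 - 1"
    using pos by (intro ln_le_minus_one) auto
  also have "\<dots> = eps * (exp y1 - 1 - y1) + (1 - eps) * (exp y0 - 1 - y0)"
  proof -
    have "exp y1 = exp s * exp y0"
      by (simp add: y0_def y1_def algebra_simps flip: exp_add)
    moreover have "eps * y1 + (1 - eps) * y0 = 0"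
      by (simp add: y0_def y1_def algebra_simps)
    ultimately show ?thesis by (simp add: algebra_simps)
  qed
  also have "\<dots> \<le> eps * (y1\<^sup>2 / 2 / (1 - y1 / 3)) + (1 - eps) * (y0\<^sup>2 / 2 / (1 - y1 / 3))"
    using eps s \<open>y0 \<le> y1\<close>
    by (intro add_mono mult_left_mono exp_minus_linear_le_uniform) (auto simp: y1_def)
  also have "\<dots> = (eps * y1\<^sup>2 + (1 - eps) * y0\<^sup>2) / 2 / (1 - y1 / 3)"
    by (simp add: add_divide_distrib)
  also have "eps * y1\<^sup>2 + (1 - eps) * y0\<^sup>2 = eps * (1 - eps) * s\<^sup>2"
    by (simp add: y0_def y1_def power2_eq_square algebra_simps)
  finally show ?thesis by (simp add: y1_def)
qed

lemma bernstein_legendre_transform: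
  fixes V b t :: real
  assumes "0 < V" "0 \<le> b" "0 \<le> t"
  obtains \<theta> where "0 \<le> \<theta>" "b * \<theta> < 3"
    "V * \<theta>\<^sup>2 / 2 / (1 - b * \<theta> / 3) - \<theta> * t = - (t\<^sup>2 / 2) / (V + b * t / 3)"
proof
  define D where "D = V + b * t / 3"
  have D_pos: "0 < D" using assms by (simp add: D_def add_pos_nonneg)
  have one_minus: "1 - b * (t / D) / 3 = V / D"
  proof -
    have "1 - b * (t / D) / 3 = (D - b * t / 3) / D"
      using D_pos by (simp add: diff_divide_distrib)
    then show ?thesis by (simp add: D_def)
  qed
  show "0 \<le> t / D" using assms D_pos by simp
  have "0 < 1 - b * (t / D) / 3" unfolding one_minus using assms D_pos by simp
  then show "b * (t / D) < 3" by simp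
  show "V * (t / D)\<^sup>2 / 2 / (1 - b * (t / D) / 3) - t / D * t = - (t\<^sup>2 / 2) / (V + b * t / 3)"
    unfolding one_minus D_def[symmetric] using assms D_pos
    by (simp add: field_simps power2_eq_square)
qed

lemma gronwall_differential:
  fixes m c :: "real \<Rightarrow> real"
  assumes m_deriv: "\<And>s. (m has_real_derivative m' s) (at s)"
    and c_deriv: "\<And>s. (c has_real_derivative c' s) (at s)"
    and deriv_le: "\<And>s. 0 \<le> s \<Longrightarrow> m' s \<le> c' s * m s"
    and "0 \<le> t"
  shows "m t \<le> m 0 * exp (c t - c 0)"
proof -
  have "m t * exp (- c t) \<le> m 0 * exp (- c 0)"
  proof (rule DERIV_nonpos_imp_nonincreasing[OF \<open>0 \<le> t\<close>])
    fix s :: real assume "0 \<le> s"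
    have "((\<lambda>s. m s * exp (- c s)) has_real_derivative (m' s - c' s * m s) * exp (- c s)) (at s)"
      by (auto intro!: derivative_eq_intros m_deriv c_deriv simp: algebra_simps)
    moreover have "(m' s - c' s * m s) * exp (- c s) \<le> 0"
      using deriv_le[OF \<open>0 \<le> s\<close>] by (simp add: mult_nonpos_nonneg)
    ultimately show "\<exists>D. ((\<lambda>s. m s * exp (- c s)) has_real_derivative D) (at s) \<and> D \<le> 0"
      by blast
  qed
  then show ?thesis by (simp add: exp_minus exp_diff field_simps)
qed

section \<open>Bernstein inequality for random sums of rank-one matrices\<close>

definition eigenvalues_less :: "nat \<Rightarrow> (nat \<Rightarrow> nat \<Rightarrow> real) \<Rightarrow> real \<Rightarrow> bool" where
  "eigenvalues_less n K t \<longleftrightarrow> (\<forall>x. 0 < dot n x x \<longrightarrow> quad_form n K x < t * dot n x x)"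

lemma trace_pow_Suc_rank_one_sum:
  fixes S :: "'e set" and c :: "'e \<Rightarrow> real" and p :: "'e \<Rightarrow> nat \<Rightarrow> real"
  defines "K \<equiv> rank_one_sum S c p"
  shows "trace_pow n K (Suc k) = (\<Sum>e\<in>S. c e * moment n K (p e) k)"
proof -
  let ?pow = "\<lambda>v. (mat_vec n K ^^ k) v"
  have "moment n K (unit_vec i) (Suc k)
      = (\<Sum>e\<in>S. c e * (dot n (p e) (unit_vec i) * dot n (?pow (p e)) (unit_vec i)))" for i
    by (simp add: moment_def K_def dot_mat_vec_rank_one_sum
        dot_mat_vec_pow_commute[OF sym_mat_rank_one_sum] mult.assoc)
  then have "trace_pow n K (Suc k)
      = (\<Sum>e\<in>S. c e * (\<Sum>i<n. dot n (p e) (unit_vec i) * dot n (?pow (p e)) (unit_vec i)))"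
    by (simp add: trace_pow_def sum_distrib_left) (rule sum.swap)
  then show ?thesis
    by (simp add: sum_dot_unit moment_def)
qed

lemma has_real_derivative_trace_exp_rank_one_sum:
  fixes S :: "'e set" and c :: "'e \<Rightarrow> real" and p :: "'e \<Rightarrow> nat \<Rightarrow> real"
  defines "K \<equiv> rank_one_sum S c p"
  shows "(trace_exp n K has_real_derivative (\<Sum>e\<in>S. c e * exp_form n K (p e) \<theta>)) (at \<theta>)"
proof -
  define a where "a k = trace_pow n K k / fact k" for k
  have a_sums: "(\<lambda>k. a k * \<theta> ^ k) sums trace_exp n K \<theta>" for \<theta>
    unfolding a_def by (rule trace_exp_sums)
  then have "trace_exp n K = (\<lambda>\<theta>. \<Sum>k. a k * \<theta> ^ k)"
    by (simp add: fun_eq_iff sums_iff)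
  then have "(trace_exp n K has_real_derivative (\<Sum>k. diffs a k * \<theta> ^ k)) (at \<theta>)"
    using termdiffs_strong_converges_everywhere[OF sums_summable[OF a_sums]] by simp
  moreover have "(\<lambda>k. diffs a k * \<theta> ^ k) sums (\<Sum>e\<in>S. c e * exp_form n K (p e) \<theta>)"
  proof -
    have "diffs a k = trace_pow n K (Suc k) / fact k" for k
      by (simp add: diffs_def a_def del: of_nat_Suc)
    then have "diffs a k * \<theta> ^ k = (\<Sum>e\<in>S. c e * (moment n K (p e) k / fact k * \<theta> ^ k))" for k
      by (simp add: trace_pow_Suc_rank_one_sum K_def
          sum_divide_distrib sum_distrib_right mult.assoc)
    then show ?thesis
      by (simp only:) (intro sums_sum sums_mult exp_form_sums)
  qed
  ultimately show ?thesis
    by (simp add: sums_iff)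
qed

lemma finite_set_Pi_bernoulli:
  "finite S \<Longrightarrow> finite (set_pmf (Pi_pmf S False (\<lambda>_. bernoulli_pmf eps)))"
  by (rule finite_subset[OF set_Pi_pmf_subset' finite_PiE_dflt]) simp_all

lemma expectation_Pi_bernoulli_split:
  fixes \<Phi> :: "('e \<Rightarrow> bool) \<Rightarrow> real"
  assumes "finite S" "e \<in> S" "0 \<le> eps" "eps \<le> 1"
  shows "measure_pmf.expectation (Pi_pmf S False (\<lambda>_. bernoulli_pmf eps)) \<Phi>
    = measure_pmf.expectation (Pi_pmf (S - {e}) False (\<lambda>_. bernoulli_pmf eps))
        (\<lambda>Z. eps * \<Phi> (Z(e := True)) + (1 - eps) * \<Phi> (Z(e := False)))"
proof -
  let ?R = "Pi_pmf (S - {e}) False (\<lambda>_. bernoulli_pmf eps)"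
  have fin: "finite (set_pmf ?R)"
    using assms by (simp add: finite_set_Pi_bernoulli)
  have "Pi_pmf S False (\<lambda>_. bernoulli_pmf eps)
      = bernoulli_pmf eps \<bind> (\<lambda>y. map_pmf (\<lambda>Z. Z(e := y)) ?R)"
    using Pi_pmf_insert'[of "S - {e}" e False "\<lambda>_. bernoulli_pmf eps"] assms(1)
    unfolding map_pmf_def insert_Diff[OF \<open>e \<in> S\<close>] by blast
  then have "measure_pmf.expectation (Pi_pmf S False (\<lambda>_. bernoulli_pmf eps)) \<Phi>
      = measure_pmf.expectation (bernoulli_pmf eps \<bind> (\<lambda>y. map_pmf (\<lambda>Z. Z(e := y)) ?R)) \<Phi>"
    by simp
  also have "\<dots> = (\<Sum>y\<in>UNIV. pmf (bernoulli_pmf eps) y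
      *\<^sub>R measure_pmf.expectation (map_pmf (\<lambda>Z. Z(e := y)) ?R) \<Phi>)"
    using fin
    by (intro pmf_expectation_bind) (simp_all only: set_map_pmf finite_imageI subset_UNIV finite)
  also have "\<dots> = eps * measure_pmf.expectation ?R (\<lambda>Z. \<Phi> (Z(e := True)))
        + (1 - eps) * measure_pmf.expectation ?R (\<lambda>Z. \<Phi> (Z(e := False)))"
    using assms by (simp add: UNIV_bool)
  finally show ?thesis
    by (simp add: integrable_measure_pmf_finite[OF fin])
qed

locale bernoulli_rank_one_sum =
  fixes n :: nat and S :: "'e set" and p :: "'e \<Rightarrow> nat \<Rightarrow> real" and eps \<kappa> R :: real
  assumes finite_index: "finite S"
    and eps: "0 < eps" "eps < 1"
    and norm_bound: "e \<in> S \<Longrightarrow> dot n (p e) (p e) \<le> R"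
    and frame_bound: "(\<Sum>e\<in>S. (dot n (p e) x)\<^sup>2) \<le> \<kappa> * dot n x x"
    and bounds_pos: "0 < R" "0 < \<kappa>"
begin

abbreviation noise :: "('e \<Rightarrow> bool) pmf" where
  "noise \<equiv> Pi_pmf S False (\<lambda>_. bernoulli_pmf eps)"

abbreviation expect :: "(('e \<Rightarrow> bool) \<Rightarrow> real) \<Rightarrow> real" where
  "expect \<equiv> measure_pmf.expectation noise"

abbreviation centered_sum :: "('e \<Rightarrow> bool) \<Rightarrow> nat \<Rightarrow> nat \<Rightarrow> real" where
  "centered_sum Z \<equiv> rank_one_sum S (\<lambda>e. of_bool (Z e) - eps) p"

lemma integrable_noise: "integrable (measure_pmf noise) f" for f :: "_ \<Rightarrow> real"
  by (rule integrable_measure_pmf_finite[OF finite_set_Pi_bernoulli[OF finite_index]])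

lemma expect_eq_sum:
  "expect f = (\<Sum>Z\<in>set_pmf noise. pmf noise Z * f Z)" for f :: "_ \<Rightarrow> real"
  using integral_measure_pmf[OF finite_set_Pi_bernoulli[OF finite_index], of noise f] by simp

lemma centered_sum_flip:
  assumes "e \<in> S"
  shows "centered_sum (Z(e := True)) = rank_one_update (centered_sum (Z(e := False))) (p e)"
proof (intro ext)
  fix i j
  have "(\<Sum>e'\<in>S - {e}. (of_bool ((Z(e := b)) e') - eps) * p e' i * p e' j)
      = (\<Sum>e'\<in>S - {e}. (of_bool (Z e') - eps) * p e' i * p e' j)" for b
    by (intro sum.cong) auto
  then show "centered_sum (Z(e := True)) i j
      = rank_one_update (centered_sum (Z(e := False))) (p e) i j"
    unfolding rank_one_sum_def rank_one_update_def sum.remove[OF finite_index assms]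
    by (simp add: algebra_simps)
qed

lemma exp_form_flip_le:
  assumes "e \<in> S" "0 \<le> \<theta>"
  shows "exp_form n (centered_sum (Z(e := True))) (p e) \<theta>
    \<le> exp (R * \<theta>) * exp_form n (centered_sum (Z(e := False))) (p e) \<theta>"
proof -
  have "exp_form n (centered_sum (Z(e := True))) (p e) \<theta>
      \<le> exp (dot n (p e) (p e) * \<theta>) * exp_form n (centered_sum (Z(e := False))) (p e) \<theta>"
    unfolding centered_sum_flip[OF \<open>e \<in> S\<close>]
    by (rule exp_form_rank_one_update_le[OF sym_mat_rank_one_sum \<open>0 \<le> \<theta>\<close>])
  also have "\<dots> \<le> exp (R * \<theta>) * exp_form n (centered_sum (Z(e := False))) (p e) \<theta>"
    using assms norm_bound
    by (intro mult_right_mono exp_form_nonneg sym_mat_rank_one_sum) (simp_all add: mult_right_mono)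
  finally show ?thesis .
qed

lemma expect_centered_exp_form_le:
  assumes "e \<in> S" "0 \<le> \<theta>"
  shows "expect (\<lambda>Z. (of_bool (Z e) - eps) * exp_form n (centered_sum Z) (p e) \<theta>)
    \<le> bernoulli_cgf_deriv eps (R * \<theta>) * expect (\<lambda>Z. exp_form n (centered_sum Z) (p e) \<theta>)"
proof -
  define F where "F Z = exp_form n (centered_sum Z) (p e) \<theta>" for Z
  let ?r = "bernoulli_cgf_deriv eps (R * \<theta>)"
  let ?Q = "Pi_pmf (S - {e}) False (\<lambda>_. bernoulli_pmf eps)"
  have integrable: "integrable (measure_pmf ?Q) f" for f :: "_ \<Rightarrow> real"
    using finite_index by (intro integrable_measure_pmf_finite finite_set_Pi_bernoulli) simp
  note split = expectation_Pi_bernoulli_split[OF finite_index \<open>e \<in> S\<close>, of eps]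
  have "expect (\<lambda>Z. (of_bool (Z e) - eps) * F Z)
      = measure_pmf.expectation ?Q (\<lambda>Z. eps * ((1 - eps) * F (Z(e := True)))
          + (1 - eps) * (- eps * F (Z(e := False))))"
    using split[of "\<lambda>Z. (of_bool (Z e) - eps) * F Z"] eps by simp
  also have "\<dots> \<le> measure_pmf.expectation ?Q
      (\<lambda>Z. ?r * (eps * F (Z(e := True)) + (1 - eps) * F (Z(e := False))))"
    using eps exp_form_flip_le[OF assms] unfolding F_def
    by (intro integral_mono integrable bernoulli_covariance_le) auto
  also have "\<dots> = ?r * expect F"
    using split[of F] eps by simp
  finally show ?thesis unfolding F_def .
qed

lemma expect_trace_exp_deriv_le:
  assumes "0 \<le> \<theta>"
  shows "expect (\<lambda>Z. \<Sum>e\<in>S. (of_bool (Z e) - eps) * exp_form n (centered_sum Z) (p e) \<theta>)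
    \<le> \<kappa> * bernoulli_cgf_deriv eps (R * \<theta>) * expect (\<lambda>Z. trace_exp n (centered_sum Z) \<theta>)"
proof -
  let ?F = "\<lambda>e Z. exp_form n (centered_sum Z) (p e) \<theta>" and ?r = "bernoulli_cgf_deriv eps (R * \<theta>)"
  have deriv_nonneg: "0 \<le> ?r"
    using eps bounds_pos assms by (intro bernoulli_cgf_deriv_nonneg) auto
  have "expect (\<lambda>Z. \<Sum>e\<in>S. (of_bool (Z e) - eps) * ?F e Z)
      = (\<Sum>e\<in>S. expect (\<lambda>Z. (of_bool (Z e) - eps) * ?F e Z))"
    by (rule Bochner_Integration.integral_sum) (rule integrable_noise)
  also have "\<dots> \<le> (\<Sum>e\<in>S. ?r * expect (?F e))"
    by (intro sum_mono expect_centered_exp_form_le assms)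
  also have "\<dots> = ?r * expect (\<lambda>Z. \<Sum>e\<in>S. ?F e Z)"
    by (simp add: integrable_noise sum_distrib_left)
  also have "\<dots> \<le> ?r * expect (\<lambda>Z. \<kappa> * trace_exp n (centered_sum Z) \<theta>)"
    by (intro mult_left_mono integral_mono integrable_noise deriv_nonneg
        sum_exp_form_le_trace_exp sym_mat_rank_one_sum assms frame_bound)
  finally show ?thesis by (simp add: mult_ac)
qed

lemma expect_trace_exp_le:
  assumes "0 \<le> \<theta>"
  shows "expect (\<lambda>Z. trace_exp n (centered_sum Z) \<theta>)
    \<le> real n * exp (\<kappa> / R * bernoulli_cgf eps (R * \<theta>))"
proof -
  define m where "m \<theta> = expect (\<lambda>Z. trace_exp n (centered_sum Z) \<theta>)" for \<theta>
  define c where "c \<theta> = \<kappa> / R * bernoulli_cgf eps (R * \<theta>)" for \<theta>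
  have "m \<theta> \<le> m 0 * exp (c \<theta> - c 0)"
  proof (rule gronwall_differential[OF _ _ _ assms])
    fix \<theta>
    show "(m has_real_derivative expect
        (\<lambda>Z. \<Sum>e\<in>S. (of_bool (Z e) - eps) * exp_form n (centered_sum Z) (p e) \<theta>)) (at \<theta>)"
      unfolding m_def expect_eq_sum
      by (intro DERIV_sum DERIV_cmult has_real_derivative_trace_exp_rank_one_sum)
    show "(c has_real_derivative \<kappa> * bernoulli_cgf_deriv eps (R * \<theta>)) (at \<theta>)"
      unfolding c_def using eps bounds_pos
      by (auto intro!: derivative_eq_intros DERIV_chain2[OF has_real_derivative_bernoulli_cgf])
  qed (simp add: m_def expect_trace_exp_deriv_le)
  moreover have "m 0 = real n" "c 0 = 0"
    by (simp_all add: m_def c_def trace_exp_0 bernoulli_cgf_def)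
  ultimately have "m \<theta> \<le> real n * exp (c \<theta>)" by simp
  then show ?thesis by (simp only: m_def c_def)
qed

lemma exp_le_trace_exp_if_not_eigenvalues_less:
  assumes "\<not> eigenvalues_less n (centered_sum Z) t" "0 \<le> \<theta>"
  shows "exp (\<theta> * t) \<le> trace_exp n (centered_sum Z) \<theta>"
proof -
  obtain x where x_pos: "0 < dot n x x" and "t * dot n x x \<le> quad_form n (centered_sum Z) x"
    using assms(1) by (auto simp: eigenvalues_less_def not_less)
  then have "t \<le> quad_form n (centered_sum Z) x / dot n x x"
    by (simp add: pos_le_divide_eq)
  then have "\<theta> * t \<le> quad_form n (centered_sum Z) x / dot n x x * \<theta>"
    using \<open>0 \<le> \<theta>\<close> by (subst mult.commute) (rule mult_right_mono)
  then have "dot n x x * exp (\<theta> * t)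
      \<le> dot n x x * exp (quad_form n (centered_sum Z) x / dot n x x * \<theta>)"
    using x_pos by simp
  also have "\<dots> \<le> exp_form n (centered_sum Z) x \<theta>"
    by (rule exp_rayleigh_le_exp_form[OF sym_mat_rank_one_sum x_pos \<open>0 \<le> \<theta>\<close>])
  also have "\<dots> \<le> dot n x x * trace_exp n (centered_sum Z) \<theta>"
    by (rule exp_form_le_trace_exp[OF sym_mat_rank_one_sum \<open>0 \<le> \<theta>\<close>])
  finally show ?thesis using x_pos by simp
qed

theorem bernstein_rank_one:
  assumes "0 \<le> t"
  shows "1 - real n * exp (- (t\<^sup>2 / 2) / (\<kappa> * R * eps * (1 - eps) + R * (1 - eps) * t / 3))
    \<le> measure_pmf.prob noise {Z. eigenvalues_less n (centered_sum Z) t}"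
proof -
  define V where "V = \<kappa> * R * eps * (1 - eps)"
  define b where "b = R * (1 - eps)"
  have V: "0 < V" and b: "0 \<le> b" using bounds_pos eps by (simp_all add: V_def b_def)
  obtain \<theta> where \<theta>: "0 \<le> \<theta>" "b * \<theta> < 3"
    "V * \<theta>\<^sup>2 / 2 / (1 - b * \<theta> / 3) - \<theta> * t = - (t\<^sup>2 / 2) / (V + b * t / 3)"
    using bernstein_legendre_transform[OF V b assms] .
  have "\<kappa> / R * bernoulli_cgf eps (R * \<theta>)
      \<le> \<kappa> / R * (eps * (1 - eps) * (R * \<theta>)\<^sup>2 / 2 / (1 - (1 - eps) * (R * \<theta>) / 3))"
    using eps bounds_pos \<theta> by (intro mult_left_mono bernoulli_cgf_le) (simp_all add: b_def mult_ac)
  also have "\<dots> = V * \<theta>\<^sup>2 / 2 / (1 - b * \<theta> / 3)"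
    using bounds_pos by (simp add: V_def b_def power2_eq_square mult_ac)
  finally have cgf: "\<kappa> / R * bernoulli_cgf eps (R * \<theta>) - \<theta> * t \<le> - (t\<^sup>2 / 2) / (V + b * t / 3)"
    using \<theta>(3) by linarith
  let ?M = "\<lambda>Z. trace_exp n (centered_sum Z) \<theta>"
  have "measure_pmf.prob noise (- {Z. eigenvalues_less n (centered_sum Z) t})
      \<le> measure_pmf.prob noise {Z. exp (\<theta> * t) \<le> ?M Z}"
    using exp_le_trace_exp_if_not_eigenvalues_less \<theta>(1)
    by (intro measure_pmf.finite_measure_mono) auto
  also have "\<dots> \<le> expect ?M / exp (\<theta> * t)"
    using integral_Markov_inequality_measure[OF integrable_noise, of UNIV ?M "exp (\<theta> * t)"] \<theta>(1)
    by (simp add: trace_exp_nonneg sym_mat_rank_one_sum)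
  also have "\<dots> \<le> real n * exp (\<kappa> / R * bernoulli_cgf eps (R * \<theta>)) / exp (\<theta> * t)"
    using expect_trace_exp_le[OF \<theta>(1)] by (intro divide_right_mono) auto
  also have "\<dots> = real n * exp (\<kappa> / R * bernoulli_cgf eps (R * \<theta>) - \<theta> * t)"
    by (simp add: exp_diff)
  also have "\<dots> \<le> real n * exp (- (t\<^sup>2 / 2) / (V + b * t / 3))"
    using cgf by (intro mult_left_mono) auto
  finally show ?thesis
    unfolding V_def b_def
    using measure_pmf.prob_compl[of "{Z. eigenvalues_less n (centered_sum Z) t}" noise]
    by (simp add: Compl_eq_Diff_UNIV)
qed

end

section \<open>Dual certificates for the semidefinite program\<close>

definition conj_mat :: "(nat \<Rightarrow> real) \<Rightarrow> (nat \<Rightarrow> nat \<Rightarrow> real) \<Rightarrow> nat \<Rightarrow> nat \<Rightarrow> real" where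
  "conj_mat g X = (\<lambda>i j. g i * g j * X i j)"

definition dirichlet_form :: "nat \<Rightarrow> (nat \<Rightarrow> nat \<Rightarrow> real) \<Rightarrow> (nat \<Rightarrow> real) \<Rightarrow> real" where
  "dirichlet_form n B v = (\<Sum>i<n. \<Sum>j<n. B i j * (v i - v j)\<^sup>2)"

lemma conj_mat_involution:
  assumes "\<And>i. g i * g i = 1"
  shows "conj_mat g (conj_mat g X) = X"
proof (intro ext)
  fix i j
  have "conj_mat g (conj_mat g X) i j = (g i * g i) * (g j * g j) * X i j"
    by (simp add: conj_mat_def mult_ac)
  then show "conj_mat g (conj_mat g X) i j = X i j"
    by (simp add: assms)
qed

lemma tr_prod_conj_mat: "tr_prod n (conj_mat g W) X = tr_prod n W (conj_mat g X)"
  by (simp add: tr_prod_def conj_mat_def mult_ac)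

lemma sdp_feasible_conj_mat:
  assumes "\<And>i. g i * g i = 1" and "sdp_feasible n X"
  shows "sdp_feasible n (conj_mat g X)"
proof -
  have "quad_form n (conj_mat g X) v = quad_form n X (\<lambda>i. g i * v i)" for v
    by (simp add: quad_form_def conj_mat_def mult_ac)
  then show ?thesis
    using assms by (simp add: sdp_feasible_def psd_def) (simp add: conj_mat_def mult.commute)
qed

lemma sdp_unique_opt_conj_mat:
  assumes signs: "\<And>i. g i * g i = 1" and opt: "sdp_unique_opt n W X\<^sub>0"
  shows "sdp_unique_opt n (conj_mat g W) (conj_mat g X\<^sub>0)"
  unfolding sdp_unique_opt_def tr_prod_conj_mat conj_mat_involution[OF signs]
proof (intro conjI allI impI)
  show "sdp_feasible n (conj_mat g X\<^sub>0)"
    using opt by (intro sdp_feasible_conj_mat signs) (simp add: sdp_unique_opt_def)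
  show "tr_prod n W (conj_mat g X) \<le> tr_prod n W X\<^sub>0" if "sdp_feasible n X" for X
    using opt sdp_feasible_conj_mat[OF signs that] by (simp add: sdp_unique_opt_def)
  fix X i j
  assume optimal: "sdp_feasible n X \<and> tr_prod n W (conj_mat g X) = tr_prod n W X\<^sub>0"
    and "i < n" "j < n"
  with optimal have "conj_mat g X i j = X\<^sub>0 i j"
    using opt sdp_feasible_conj_mat[of g n X] signs by (simp add: sdp_unique_opt_def)
  then have "conj_mat g (conj_mat g X) i j = conj_mat g X\<^sub>0 i j"
    by (simp add: conj_mat_def)
  then show "X i j = conj_mat g X\<^sub>0 i j"
    by (simp add: conj_mat_involution signs)
qed

lemma sdp_feasible_all_ones: "sdp_feasible n (\<lambda>_ _. 1)"
proof -
  have "quad_form n (\<lambda>_ _. 1) v = (\<Sum>i<n. v i)\<^sup>2" for v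
    by (simp add: quad_form_def power2_eq_square sum_product)
  then show ?thesis by (simp add: sdp_feasible_def psd_def)
qed

lemma sdp_duality_gap:
  fixes w :: "nat \<Rightarrow> nat \<Rightarrow> real"
  assumes feasible: "sdp_feasible n X"
    and gram: "\<And>i j. i < n \<Longrightarrow> j < n \<Longrightarrow> X i j = (\<Sum>l<n. w l i * w l j)"
  shows "(\<Sum>l<n. dirichlet_form n B (w l)) = 2 * (tr_prod n B (\<lambda>_ _. 1) - tr_prod n B X)"
proof -
  have sum_sq_diff: "(\<Sum>l<n. (w l i - w l j)\<^sup>2) = 2 - 2 * X j i" if "i < n" "j < n" for i j
  proof -
    have "(\<Sum>l<n. (w l i - w l j)\<^sup>2) = X i i + X j j - 2 * X j i"
      by (simp add: gram that power2_eq_square algebra_simps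
          sum.distrib sum_subtractf sum_distrib_left)
    then show ?thesis using feasible that by (simp add: sdp_feasible_def)
  qed
  have "(\<Sum>l<n. dirichlet_form n B (w l)) = (\<Sum>i<n. \<Sum>j<n. B i j * (\<Sum>l<n. (w l i - w l j)\<^sup>2))"
    unfolding dirichlet_form_def sum_distrib_left
    by (subst sum.swap) (intro sum.cong[OF refl] sum.swap)
  also have "\<dots> = (\<Sum>i<n. \<Sum>j<n. 2 * (B i j - B i j * X j i))"
    by (intro sum.cong refl) (simp add: sum_sq_diff algebra_simps)
  also have "\<dots> = 2 * (tr_prod n B (\<lambda>_ _. 1) - tr_prod n B X)"
    by (simp add: tr_prod_def sum_subtractf flip: sum_distrib_left)
  finally show ?thesis .
qed

lemma dirichlet_form_nonneg_if_pos:
  assumes pos: "\<And>i j. i < n \<Longrightarrow> j < n \<Longrightarrow> v i \<noteq> v j \<Longrightarrow> 0 < dirichlet_form n B v"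
  shows "0 \<le> dirichlet_form n B v"
proof (cases "\<exists>i<n. \<exists>j<n. v i \<noteq> v j")
  case True
  then obtain i j where "i < n" "j < n" "v i \<noteq> v j" by blast
  from pos[OF this] show ?thesis by (rule less_imp_le)
next
  case False
  then obtain c where "\<And>i. i < n \<Longrightarrow> v i = c" by metis
  then show ?thesis by (simp add: dirichlet_form_def)
qed

lemma sdp_unique_opt_all_ones:
  assumes pos: "\<And>v i j. i < n \<Longrightarrow> j < n \<Longrightarrow> v i \<noteq> v j \<Longrightarrow> 0 < dirichlet_form n B v"
  shows "sdp_unique_opt n B (\<lambda>_ _. 1)"
proof -
  have nonneg: "0 \<le> dirichlet_form n B v" for v
    using pos by (rule dirichlet_form_nonneg_if_pos)
  show ?thesis
    unfolding sdp_unique_opt_def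
  proof (intro conjI allI impI sdp_feasible_all_ones)
    fix X assume feasible: "sdp_feasible n X"
    then have "psd n X" by (simp add: sdp_feasible_def)
    obtain w where "\<And>i j. i < n \<Longrightarrow> j < n \<Longrightarrow> X i j = (\<Sum>l<n. w l i * w l j)"
      using psd_gram_decomposition[OF \<open>psd n X\<close>] by blast
    from sdp_duality_gap[OF feasible this, of B] show "tr_prod n B X \<le> tr_prod n B (\<lambda>_ _. 1)"
      using sum_nonneg[of "{..<n}" "\<lambda>l. dirichlet_form n B (w l)"] nonneg by simp
  next
    fix X i j
    assume optimal: "sdp_feasible n X \<and> tr_prod n B X = tr_prod n B (\<lambda>_ _. 1)"
      and ij: "i < n" "j < n"
    then have "psd n X" by (simp add: sdp_feasible_def)
    obtain w where gram: "\<And>i j. i < n \<Longrightarrow> j < n \<Longrightarrow> X i j = (\<Sum>l<n. w l i * w l j)"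
      using psd_gram_decomposition[OF \<open>psd n X\<close>] by blast
    have "(\<Sum>l<n. dirichlet_form n B (w l)) = 0"
      using optimal by (simp add: sdp_duality_gap[OF _ gram])
    then have "dirichlet_form n B (w l) = 0" if "l < n" for l
      using that nonneg by (simp add: sum_nonneg_eq_0_iff)
    then have "w l j = w l i" if "l < n" for l
      using pos[OF ij, of "w l"] that by force
    then have "X i j = X i i"
      by (simp add: gram ij)
    then show "X i j = 1" using optimal ij by (simp add: sdp_feasible_def)
  qed
qed

section \<open>Laplacian of a regular graph\<close>

lemma sum_sym_mat_swap:
  assumes "sym_mat n B"
  shows "(\<Sum>i<n. \<Sum>j<n. B i j * f j) = (\<Sum>i<n. (\<Sum>j<n. B i j) * f i)"
proof -
  have "(\<Sum>i<n. \<Sum>j<n. B i j * f j) = (\<Sum>j<n. \<Sum>i<n. B j i * f j)"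
    using assms by (subst sum.swap) (simp add: sym_mat_def)
  then show ?thesis by (simp add: sum_distrib_right)
qed

lemma dirichlet_form_eq_quad_form:
  assumes "sym_mat n B"
  shows "dirichlet_form n B v = 2 * ((\<Sum>i<n. (\<Sum>j<n. B i j) * (v i)\<^sup>2) - quad_form n B v)"
proof -
  have "dirichlet_form n B v
      = (\<Sum>i<n. \<Sum>j<n. B i j * (v i)\<^sup>2) + (\<Sum>i<n. \<Sum>j<n. B i j * (v j)\<^sup>2) - 2 * quad_form n B v"
    by (simp add: dirichlet_form_def quad_form_def power2_eq_square algebra_simps
        sum.distrib sum_subtractf sum_distrib_left)
  then show ?thesis
    unfolding sum_sym_mat_swap[OF assms] by (simp add: sum_distrib_right)
qed

lemma abs_quad_form_le_row_sums:
  assumes "sym_mat n B"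
  shows "\<bar>quad_form n B v\<bar> \<le> (\<Sum>i<n. (\<Sum>j<n. \<bar>B i j\<bar>) * (v i)\<^sup>2)"
proof -
  have abs_sym: "sym_mat n (\<lambda>i j. \<bar>B i j\<bar>)"
    using assms by (simp add: sym_mat_def)
  have term_le: "\<bar>v i * B i j * v j\<bar> \<le> (\<bar>B i j\<bar> * (v i)\<^sup>2 + \<bar>B i j\<bar> * (v j)\<^sup>2) / 2" for i j
  proof -
    have "\<bar>v i\<bar> * \<bar>v j\<bar> \<le> ((v i)\<^sup>2 + (v j)\<^sup>2) / 2"
      using sum_squares_bound[of "\<bar>v i\<bar>" "\<bar>v j\<bar>"] by simp
    from mult_left_mono[OF this, of "\<bar>B i j\<bar>"] show ?thesis
      by (simp add: abs_mult algebra_simps)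
  qed
  have "\<bar>quad_form n B v\<bar> \<le> (\<Sum>i<n. \<Sum>j<n. \<bar>v i * B i j * v j\<bar>)"
    unfolding quad_form_def by (intro order_trans[OF sum_abs] sum_mono sum_abs)
  also have "\<dots> \<le> (\<Sum>i<n. \<Sum>j<n. (\<bar>B i j\<bar> * (v i)\<^sup>2 + \<bar>B i j\<bar> * (v j)\<^sup>2) / 2)"
    by (intro sum_mono term_le)
  also have "\<dots> = ((\<Sum>i<n. \<Sum>j<n. \<bar>B i j\<bar> * (v i)\<^sup>2) + (\<Sum>i<n. \<Sum>j<n. \<bar>B i j\<bar> * (v j)\<^sup>2)) / 2"
    by (simp add: sum.distrib flip: sum_divide_distrib)
  also have "\<dots> = (\<Sum>i<n. (\<Sum>j<n. \<bar>B i j\<bar>) * (v i)\<^sup>2)"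
    unfolding sum_sym_mat_swap[OF abs_sym] by (simp add: sum_distrib_right)
  finally show ?thesis .
qed

lemma rayleigh_perp_eq:
  "rayleigh_perp n M = {quad_form n M x / dot n x x | x. (\<Sum>i<n. x i) = 0 \<and> 0 < dot n x x}"
  unfolding rayleigh_perp_def dot_self_pos_iff by (simp add: dot_def power2_eq_square)

lemma quad_form_uminus: "quad_form n (\<lambda>i j. - M i j) x = - quad_form n M x"
  by (simp add: quad_form_def sum_negf)

lemma uminus_rayleigh_perp: "uminus ` rayleigh_perp n M = rayleigh_perp n (\<lambda>i j. - M i j)"
  unfolding rayleigh_perp_eq by (auto simp: quad_form_uminus image_def)

lemma quad_form_le_Sup_rayleigh_perp:
  assumes bound: "\<And>x. quad_form n M x \<le> C * dot n x x" and mean_0: "(\<Sum>i<n. x i) = 0"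
  shows "quad_form n M x \<le> Sup (rayleigh_perp n M) * dot n x x"
proof (cases "0 < dot n x x")
  case True
  have "bdd_above (rayleigh_perp n M)"
    unfolding rayleigh_perp_eq bdd_above_def
    using bound by (auto simp: pos_divide_le_eq intro!: exI[of _ C])
  then have "quad_form n M x / dot n x x \<le> Sup (rayleigh_perp n M)"
    using mean_0 True by (intro cSup_upper) (auto simp: rayleigh_perp_eq)
  then show ?thesis using True by (simp add: pos_divide_le_eq)
next
  case False
  then have "dot n x x = 0" using dot_self_nonneg[of n x] by simp
  then show ?thesis using bound[of x] by simp
qed

definition edge_diff :: "nat \<times> nat \<Rightarrow> nat \<Rightarrow> real" where
  "edge_diff e = (\<lambda>k. unit_vec (fst e) k - unit_vec (snd e) k)"

definition weighted_adj :: "(nat \<Rightarrow> nat \<Rightarrow> bool) \<Rightarrow> (nat \<times> nat \<Rightarrow> real) \<Rightarrow> nat \<Rightarrow> nat \<Rightarrow> real" where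
  "weighted_adj E c = (\<lambda>i j. adj E i j * c (min i j, max i j))"

abbreviation laplacian :: "(nat \<Rightarrow> nat \<Rightarrow> bool) \<Rightarrow> (nat \<times> nat \<Rightarrow> real) \<Rightarrow> nat \<Rightarrow> nat \<Rightarrow> real" where
  "laplacian E c \<equiv> rank_one_sum (edge_set E) c edge_diff"

lemma dot_edge_diff: "i < n \<Longrightarrow> j < n \<Longrightarrow> dot n (edge_diff (i, j)) x = x i - x j"
  by (simp add: edge_diff_def dot_def unit_vec_def left_diff_distrib sum_subtractf)

lemma dot_edge_diff_self: "i < n \<Longrightarrow> j < n \<Longrightarrow> i \<noteq> j \<Longrightarrow> dot n (edge_diff (i, j)) (edge_diff (i, j)) = 2"
  by (simp add: dot_edge_diff) (simp add: edge_diff_def unit_vec_def)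

lemma sum_edge_diff: "i < n \<Longrightarrow> j < n \<Longrightarrow> (\<Sum>k<n. edge_diff (i, j) k) = 0"
  using dot_edge_diff[of i n j "\<lambda>_. 1"] by (simp add: dot_def)

lemma edge_setD: "simple_graph n E \<Longrightarrow> (i, j) \<in> edge_set E \<Longrightarrow> i < n \<and> j < n \<and> i < j"
  by (auto simp: edge_set_def simple_graph_def)

lemma finite_edge_set: "simple_graph n E \<Longrightarrow> finite (edge_set E)"
  by (rule finite_subset[of _ "{..<n} \<times> {..<n}"]) (use edge_setD in auto)

lemma edge_relation_eq:
  assumes "simple_graph n E"
  shows "{(i, j). E i j} = edge_set E \<union> prod.swap ` edge_set E"
proof -
  have "E i j \<longleftrightarrow> (i, j) \<in> edge_set E \<or> (j, i) \<in> edge_set E" for i j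
    using assms unfolding simple_graph_def edge_set_def by (cases i j rule: linorder_cases) auto
  moreover have "(i, j) \<in> prod.swap ` edge_set E \<longleftrightarrow> (j, i) \<in> edge_set E" for i j
    by force
  ultimately show ?thesis by blast
qed

lemma sum_adj_eq_sum_edges:
  assumes simple: "simple_graph n E"
  shows "(\<Sum>i<n. \<Sum>j<n. adj E i j * F i j) = (\<Sum>(i, j)\<in>edge_set E. F i j + F j i)"
proof -
  let ?S = "edge_set E"
  have "(\<Sum>i<n. \<Sum>j<n. adj E i j * F i j) = (\<Sum>(i, j)\<in>{..<n} \<times> {..<n}. adj E i j * F i j)"
    by (rule sum.cartesian_product)
  also have "\<dots> = (\<Sum>(i, j)\<in>{(i, j). E i j}. F i j)"
    using simple unfolding simple_graph_def
    by (intro sum.mono_neutral_cong_right) (auto simp: adj_def split: if_splits)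
  also have "\<dots> = (\<Sum>(i, j)\<in>?S. F i j) + (\<Sum>(i, j)\<in>prod.swap ` ?S. F i j)"
    unfolding edge_relation_eq[OF simple]
  proof (rule sum.union_disjoint)
    show "?S \<inter> prod.swap ` ?S = {}"
      by (auto simp: edge_set_def)
  qed (simp_all add: finite_edge_set[OF simple])
  also have "(\<Sum>(i, j)\<in>prod.swap ` ?S. F i j) = (\<Sum>(i, j)\<in>?S. F j i)"
    by (subst sum.reindex) (auto simp: case_prod_beta)
  finally show ?thesis
    by (simp add: sum.distrib case_prod_beta)
qed

lemma dirichlet_form_weighted_adj:
  assumes simple: "simple_graph n E"
  shows "dirichlet_form n (weighted_adj E c) v = 2 * quad_form n (laplacian E c) v"
proof -
  have "dirichlet_form n (weighted_adj E c) v = (\<Sum>(i, j)\<in>edge_set E.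
      c (min i j, max i j) * (v i - v j)\<^sup>2 + c (min j i, max j i) * (v j - v i)\<^sup>2)"
    unfolding dirichlet_form_def weighted_adj_def mult.assoc
    by (rule sum_adj_eq_sum_edges[OF simple])
  also have "\<dots> = (\<Sum>e\<in>edge_set E. 2 * (c e * (dot n (edge_diff e) v)\<^sup>2))"
  proof (intro sum.cong refl, clarify)
    fix i j assume "(i, j) \<in> edge_set E"
    then have "i < n" "j < n" "i < j" using edge_setD[OF simple] by auto
    then show "c (min i j, max i j) * (v i - v j)\<^sup>2 + c (min j i, max j i) * (v j - v i)\<^sup>2
        = 2 * (c (i, j) * (dot n (edge_diff (i, j)) v)\<^sup>2)"
      by (simp add: dot_edge_diff min_def max_def power2_commute[of "v j" "v i"])
  qed
  finally show ?thesis
    by (simp add: quad_form_rank_one_sum sum_distrib_left)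
qed

lemma sym_mat_adj: "simple_graph n E \<Longrightarrow> sym_mat n (adj E)"
  by (auto simp: simple_graph_def sym_mat_def adj_def)

lemma quad_form_laplacian_nonneg: "0 \<le> quad_form n (laplacian E (\<lambda>_. 1)) v"
  by (simp add: quad_form_rank_one_sum sum_nonneg)

lemma Wmat_eq_conj_mat:
  "Wmat E x Z = conj_mat (\<lambda>i. if x i then -1 else 1) (weighted_adj E (\<lambda>e. 1 - 2 * of_bool (Z e)))"
  by (auto simp: Wmat_def obs_def adj_def conj_mat_def weighted_adj_def fun_eq_iff)

locale regular_graph =
  fixes n d :: nat and E :: "nat \<Rightarrow> nat \<Rightarrow> bool"
  assumes order_ge_2: "n \<ge> 2" and degree_ge_1: "d \<ge> 1"
    and simple: "simple_graph n E" and regular: "regular n E d"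
begin

abbreviation spectral_gap :: real where
  "spectral_gap \<equiv> real d * (1 - lambda2 n E d)"

abbreviation laplacian_bound :: real where
  "laplacian_bound \<equiv> real d * (1 + abs_lambda_n n E d)"

lemma sum_adj_row: "i < n \<Longrightarrow> (\<Sum>j<n. adj E i j) = real d"
proof -
  assume "i < n"
  have "(\<Sum>j<n. adj E i j) = (\<Sum>j\<in>{j. j < n \<and> E i j}. 1)"
    unfolding adj_def by (rule sum.mono_neutral_cong_right) auto
  then show ?thesis
    using regular \<open>i < n\<close> by (simp add: regular_def)
qed

lemma quad_form_laplacian:
  "quad_form n (laplacian E (\<lambda>_. 1)) x = real d * dot n x x - quad_form n (adj E) x"
proof -
  have "dirichlet_form n (adj E) x = 2 * (real d * dot n x x - quad_form n (adj E) x)"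
    unfolding dirichlet_form_eq_quad_form[OF sym_mat_adj[OF simple]]
    by (simp add: sum_adj_row dot_def power2_eq_square sum_distrib_left)
  then show ?thesis
    using dirichlet_form_weighted_adj[OF simple, of "\<lambda>_. 1" x] by (simp add: weighted_adj_def)
qed

lemma abs_quad_form_adj_le: "\<bar>quad_form n (adj E) x\<bar> \<le> real d * dot n x x"
proof -
  have abs_adj: "\<bar>adj E i j\<bar> = adj E i j" for i j by (simp add: adj_def)
  show ?thesis
    using abs_quad_form_le_row_sums[OF sym_mat_adj[OF simple], of x]
    by (simp add: abs_adj sum_adj_row dot_def power2_eq_square sum_distrib_left)
qed

lemma spectral_gap_le_quad_form_laplacian:
  assumes "(\<Sum>i<n. x i) = 0"
  shows "spectral_gap * dot n x x \<le> quad_form n (laplacian E (\<lambda>_. 1)) x"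
proof -
  have "quad_form n (adj E) x \<le> Sup (rayleigh_perp n (adj E)) * dot n x x"
    using assms by (intro quad_form_le_Sup_rayleigh_perp[OF abs_le_D1[OF abs_quad_form_adj_le]])
  also have "Sup (rayleigh_perp n (adj E)) = real d * lambda2 n E d"
    using degree_ge_1 by (simp add: lambda2_def)
  finally show ?thesis
    by (simp add: quad_form_laplacian algebra_simps)
qed

lemma quad_form_laplacian_le_if_sum_0:
  assumes "(\<Sum>i<n. x i) = 0"
  shows "quad_form n (laplacian E (\<lambda>_. 1)) x \<le> laplacian_bound * dot n x x"
proof -
  have "quad_form n (\<lambda>i j. - adj E i j) x \<le> Sup (rayleigh_perp n (\<lambda>i j. - adj E i j)) * dot n x x"
    using assms abs_le_D2[OF abs_quad_form_adj_le]
    by (intro quad_form_le_Sup_rayleigh_perp[where C = "real d"]) (simp_all add: quad_form_uminus)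
  also have "Sup (rayleigh_perp n (\<lambda>i j. - adj E i j)) = real d * abs_lambda_n n E d"
    using degree_ge_1 by (simp add: abs_lambda_n_def uminus_rayleigh_perp)
  finally show ?thesis
    by (simp add: quad_form_laplacian quad_form_uminus algebra_simps)
qed

definition center :: "(nat \<Rightarrow> real) \<Rightarrow> nat \<Rightarrow> real" where
  "center x = (\<lambda>i. x i - (\<Sum>i<n. x i) / real n)"

lemma sum_center: "(\<Sum>i<n. center x i) = 0"
  using order_ge_2 by (simp add: center_def sum_subtractf)

lemma dot_center_le: "dot n (center x) (center x) \<le> dot n x x"
proof -
  define c where "c = (\<Sum>i<n. x i) / real n"
  have center: "center x i = x i - c" for i
    by (simp add: center_def c_def)
  have "dot n x x = (\<Sum>i<n. center x i * center x i + 2 * c * center x i + c\<^sup>2)"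
    unfolding dot_def by (intro sum.cong refl) (simp add: center power2_eq_square algebra_simps)
  also have "\<dots> = dot n (center x) (center x) + real n * c\<^sup>2"
    by (simp add: sum.distrib sum_center dot_def flip: sum_distrib_left)
  finally show ?thesis by simp
qed

lemma quad_form_laplacian_center:
  "quad_form n (laplacian E c) (center x) = quad_form n (laplacian E c) x"
proof -
  have "dot n (edge_diff e) (center x) = dot n (edge_diff e) x" if "e \<in> edge_set E" for e
    using that edge_setD[OF simple] by (cases e) (auto simp: dot_edge_diff center_def)
  then show ?thesis by (simp add: quad_form_rank_one_sum)
qed

lemma edge_diff_0_1:
  "dot n (edge_diff (0, 1)) (edge_diff (0, 1)) = 2"
  "(\<Sum>i<n. edge_diff (0, 1) i) = 0"
  using order_ge_2 by (auto intro!: dot_edge_diff_self sum_edge_diff)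

lemma laplacian_bound_nonneg: "0 \<le> laplacian_bound"
  using order_trans[OF quad_form_laplacian_nonneg
      quad_form_laplacian_le_if_sum_0[OF edge_diff_0_1(2)]]
  by (simp only: edge_diff_0_1)

lemma spectral_gap_le_laplacian_bound: "spectral_gap \<le> laplacian_bound"
  using order_trans[OF spectral_gap_le_quad_form_laplacian quad_form_laplacian_le_if_sum_0,
      OF edge_diff_0_1(2) edge_diff_0_1(2)]
  by (simp only: edge_diff_0_1)

lemma quad_form_laplacian_le: "quad_form n (laplacian E (\<lambda>_. 1)) x \<le> laplacian_bound * dot n x x"
proof -
  have "quad_form n (laplacian E (\<lambda>_. 1)) (center x)
      \<le> laplacian_bound * dot n (center x) (center x)"
    by (intro quad_form_laplacian_le_if_sum_0 sum_center)
  also have "\<dots> \<le> laplacian_bound * dot n x x"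
    by (intro mult_left_mono dot_center_le laplacian_bound_nonneg)
  finally show ?thesis by (simp only: quad_form_laplacian_center)
qed

section \<open>Exact recovery\<close>

abbreviation noise_laplacian :: "real \<Rightarrow> (nat \<times> nat \<Rightarrow> bool) \<Rightarrow> nat \<Rightarrow> nat \<Rightarrow> real" where
  "noise_laplacian eps Z \<equiv> laplacian E (\<lambda>e. of_bool (Z e) - eps)"

lemma quad_form_signed_laplacian:
  "quad_form n (laplacian E (\<lambda>e. 1 - 2 * of_bool (Z e))) v
    = (1 - 2 * eps) * quad_form n (laplacian E (\<lambda>_. 1)) v
      - 2 * quad_form n (noise_laplacian eps Z) v"
  unfolding quad_form_rank_one_sum sum_distrib_left sum_subtractf[symmetric]
  by (intro sum.cong refl) (simp add: algebra_simps)

lemma dirichlet_form_signed_adj_pos: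
  assumes eps: "eps < 1 / 2"
    and noise: "eigenvalues_less n (noise_laplacian eps Z) ((1 - 2 * eps) * spectral_gap / 2)"
    and nonconst: "i < n" "j < n" "v i \<noteq> v j"
  shows "0 < dirichlet_form n (weighted_adj E (\<lambda>e. 1 - 2 * of_bool (Z e))) v"
proof -
  let ?u = "center v"
  have "?u i \<noteq> 0 \<or> ?u j \<noteq> 0"
    using nonconst by (auto simp: center_def)
  then have "0 < dot n ?u ?u"
    using nonconst by (auto simp: dot_self_pos_iff)
  then have "quad_form n (noise_laplacian eps Z) ?u
      < (1 - 2 * eps) * spectral_gap / 2 * dot n ?u ?u"
    using noise unfolding eigenvalues_less_def by blast
  then have "2 * quad_form n (noise_laplacian eps Z) ?u
      < (1 - 2 * eps) * (spectral_gap * dot n ?u ?u)"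
    by (simp add: mult.assoc)
  also have "\<dots> \<le> (1 - 2 * eps) * quad_form n (laplacian E (\<lambda>_. 1)) ?u"
    using eps by (intro mult_left_mono spectral_gap_le_quad_form_laplacian sum_center) simp
  finally have "0 < quad_form n (laplacian E (\<lambda>e. 1 - 2 * of_bool (Z e))) ?u"
    by (simp add: quad_form_signed_laplacian[of Z _ eps])
  then show ?thesis
    using dirichlet_form_weighted_adj[OF simple, of "\<lambda>e. 1 - 2 * of_bool (Z e)" v]
    by (simp add: quad_form_laplacian_center)
qed

lemma sdp_unique_opt_if_noise_small:
  assumes "eps < 1 / 2"
    and "eigenvalues_less n (noise_laplacian eps Z) ((1 - 2 * eps) * spectral_gap / 2)"
  shows "sdp_unique_opt n (Wmat E x Z) (\<lambda>i j. (if x i then -1 else 1) * (if x j then -1 else 1))"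
proof -
  have "sdp_unique_opt n (weighted_adj E (\<lambda>e. 1 - 2 * of_bool (Z e))) (\<lambda>_ _. 1)"
    by (intro sdp_unique_opt_all_ones dirichlet_form_signed_adj_pos[OF assms])
  from sdp_unique_opt_conj_mat[OF _ this, of "\<lambda>i. if x i then -1 else 1"] show ?thesis
    unfolding Wmat_eq_conj_mat by (simp add: conj_mat_def)
qed

lemma bernoulli_rank_one_sum_edges:
  assumes "0 < eps" "eps < 1" and "0 < laplacian_bound"
  shows "bernoulli_rank_one_sum n (edge_set E) edge_diff eps laplacian_bound 2"
proof
  fix e assume "e \<in> edge_set E"
  then show "dot n (edge_diff e) (edge_diff e) \<le> 2"
    using edge_setD[OF simple, of "fst e" "snd e"] dot_edge_diff_self[of "fst e" n "snd e"] by auto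
next
  fix x
  show "(\<Sum>e\<in>edge_set E. (dot n (edge_diff e) x)\<^sup>2) \<le> laplacian_bound * dot n x x"
    using quad_form_laplacian_le[of x] by (simp add: quad_form_rank_one_sum)
qed (use assms finite_edge_set[OF simple] in auto)

end

lemma bernstein_exponent_ge:
  fixes d L \<beta> \<gamma> eps delta :: real
  assumes pos: "0 < d" "0 < L" "0 < \<beta>" "0 < \<gamma>" "0 < eps" "eps < 1 / 2"
    and cond: "d / L \<ge> 4 * \<gamma> / \<beta>\<^sup>2 * (1 + delta) *
      (1 / (1 - 2 * eps)\<^sup>2 + 1 / 3 * \<beta> / ((1 - 2 * eps) * \<gamma>) + 1 / 3 * \<beta> / \<gamma> - 1)"
  defines "t \<equiv> (1 - 2 * eps) * (d * \<beta>) / 2"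
  shows "(1 + delta) * L \<le> (t\<^sup>2 / 2) / (d * \<gamma> * 2 * eps * (1 - eps) + 2 * (1 - eps) * t / 3)"
proof -
  define \<mu> where "\<mu> = 1 - 2 * eps"
  define K where "K = \<gamma> * (1 - \<mu>\<^sup>2) + \<beta> * \<mu> / 3 + \<beta> * \<mu>\<^sup>2 / 3"
  have \<mu>: "0 < \<mu>" "\<mu> < 1" using pos by (simp_all add: \<mu>_def)
  then have "\<mu>\<^sup>2 < 1" by (simp add: power_less_one_iff abs_square_less_1)
  then have K: "0 < K"
    unfolding K_def using pos \<mu> by (intro add_pos_pos) simp_all
  have eps_eq: "eps = (1 - \<mu>) / 2" by (simp add: \<mu>_def)
  have denom: "d * \<gamma> * 2 * eps * (1 - eps) + 2 * (1 - eps) * t / 3 = d * K / 2"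
    unfolding t_def K_def \<mu>_def[symmetric] unfolding eps_eq
    by (simp add: power2_eq_square field_simps)
  have bracket: "\<gamma> * (1 / \<mu>\<^sup>2 + 1 / 3 * \<beta> / (\<mu> * \<gamma>) + 1 / 3 * \<beta> / \<gamma> - 1) = K / \<mu>\<^sup>2"
    unfolding K_def using pos \<mu> by (simp add: field_simps power2_eq_square)
  have "4 * (1 + delta) * (\<gamma> * (1 / \<mu>\<^sup>2 + 1 / 3 * \<beta> / (\<mu> * \<gamma>) + 1 / 3 * \<beta> / \<gamma> - 1)) / \<beta>\<^sup>2 \<le> d / L"
    using cond by (simp add: \<mu>_def mult_ac)
  then have "4 * (1 + delta) * K * L \<le> d * (\<beta>\<^sup>2 * \<mu>\<^sup>2)"
    unfolding bracket using pos \<mu> by (simp add: divide_le_eq pos_le_divide_eq mult_ac)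
  then have "d * (4 * (1 + delta) * K * L) \<le> d * (d * (\<beta>\<^sup>2 * \<mu>\<^sup>2))"
    using pos by (intro mult_left_mono) auto
  moreover have "t\<^sup>2 / 2 = d * (d * (\<beta>\<^sup>2 * \<mu>\<^sup>2)) / 8"
    unfolding t_def \<mu>_def[symmetric] by (simp add: power2_eq_square)
  ultimately have "(1 + delta) * L * (d * K / 2) \<le> t\<^sup>2 / 2"
    by (simp add: algebra_simps)
  then show ?thesis
    unfolding denom using pos K by (subst pos_le_divide_eq) auto
qed

theorem theorem5:
  fixes n d :: nat and E :: "nat \<Rightarrow> nat \<Rightarrow> bool" and x :: "nat \<Rightarrow> bool"
    and eps delta :: real
  assumes n2: "n \<ge> 2" and d1: "d \<ge> 1"
    and G: "simple_graph n E" and reg: "regular n E d"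
    and l2: "lambda2 n E d < 1"
    and eps: "0 < eps" "eps < 1/2"
    and delta: "delta > 0"
    and cond: "real d / ln (real n) \<ge>
       4 * (1 + abs_lambda_n n E d) / (1 - lambda2 n E d)\<^sup>2 * (1 + delta) *
       (1 / (1 - 2*eps)\<^sup>2
        + 1/3 * (1 - lambda2 n E d) / ((1 - 2*eps) * (1 + abs_lambda_n n E d))
        + 1/3 * (1 - lambda2 n E d) / (1 + abs_lambda_n n E d) - 1)"
  shows "measure_pmf.prob (noise_pmf E eps)
           {Z. sdp_unique_opt n (Wmat E x Z)
                 (\<lambda>i j. (if x i then -1 else 1) * (if x j then -1 else 1))}
         \<ge> 1 - real n powr (- delta)"
proof -
  interpret regular_graph n d E
    by unfold_locales (fact n2 d1 G reg)+
  define t where "t = (1 - 2 * eps) * spectral_gap / 2"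
  have t: "0 \<le> t" and bound: "0 < laplacian_bound" "0 < 1 + abs_lambda_n n E d"
    using spectral_gap_le_laplacian_bound l2 d1 eps by (auto simp: t_def intro: less_le_trans)
  interpret noisy: bernoulli_rank_one_sum n "edge_set E" edge_diff eps laplacian_bound 2
    using eps bound by (intro bernoulli_rank_one_sum_edges) auto
  have "real n * exp (- (t\<^sup>2 / 2) / (laplacian_bound * 2 * eps * (1 - eps) + 2 * (1 - eps) * t / 3))
      \<le> real n * exp (- ((1 + delta) * ln (real n)))"
    using bernstein_exponent_ge[OF _ _ _ bound(2) eps cond] n2 d1 l2 by (simp add: t_def)
  also have "\<dots> = real n powr (- delta)"
    using n2 by (simp add: powr_def algebra_simps exp_diff exp_minus field_simps exp_add)
  finally have "1 - real n powr (- delta)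
      \<le> measure_pmf.prob (noise_pmf E eps) {Z. eigenvalues_less n (noise_laplacian eps Z) t}"
    using noisy.bernstein_rank_one[OF t] by (simp add: noise_pmf_def)
  also have "\<dots> \<le> measure_pmf.prob (noise_pmf E eps) {Z. sdp_unique_opt n (Wmat E x Z)
      (\<lambda>i j. (if x i then -1 else 1) * (if x j then -1 else 1))}"
    using sdp_unique_opt_if_noise_small[OF eps(2)]
    by (intro measure_pmf.finite_measure_mono) (auto simp: t_def)
  finally show ?thesis .
qed

end
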